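(* Let $K$ be a field of characteristic zero, $X=(x_1,\dots,x_N)$, $x=(x_1,\dots,x_n)$ with $n\le N$, and $h\in K[X]$. Suppose that the first $n-1$ rows of the Hessian matrix $\mathcal{H}h$ span the row space of $\mathcal{H}h$ over $K(X)$. Then there exists $C\in\operatorname{Mat}_{N,n}(K)$ of the form $$C^{\mathrm t}=\begin{pmatrix} I_{n-1} & 0\\ 0 & (c_n\ c_{n+1}\ \cdots\ c_N)\end{pmatrix},\qquad c_nc_{n+1}\cdots c_N\ne0,$$ (i.e. $Cx=(x_1,\dots,x_{n-1},c_nx_n,c_{n+1}x_n,\dots,c_Nx_n)$) such that $C^{\mathrm t}(\nabla h)(Cx)\in K[x]^n$ and $\nabla h\in K[X]^N$ are symmetrically dB-paired over $K$ (through $C^{\mathrm t}$ and $C$).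
   Context: $\nabla h=(\partial h/\partial x_1,\dots,\partial h/\partial x_N)$. For $g\in K[x]^m$ and $G\in K[X]^M$: they are dB-paired over $K$ through $B\in\operatorname{Mat}_{m,M}(K)$ and $C\in\operatorname{Mat}_{N,n}(K)$ if $g=B\,G(Cx)$ and $\operatorname{trdeg}_K K(g)=\operatorname{trdeg}_K K(G)$ (transcendence degree over $K$ of the field generated by the components); symmetrically dB-paired if moreover $B=C^{\mathrm t}$. *)

theory Defs
  imports "HOL-Library.Poly_Mapping" "HOL-Library.Extended_Nat"
          "HOL-Computational_Algebra.Fraction_Field"
begin

text \<open>Multivariate polynomials over 'a in the variables x_0, x_1, ... (0-indexed):
  finitely supported maps from exponent vectors to coefficients.\<close>
type_synonym 'a mpoly = "(nat \<Rightarrow>\<^sub>0 nat) \<Rightarrow>\<^sub>0 'a"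

definition mconst :: "'a::comm_ring_1 \<Rightarrow> 'a mpoly" where
  "mconst c = Poly_Mapping.single 0 c"

definition mvar :: "nat \<Rightarrow> 'a::comm_ring_1 mpoly" where
  "mvar i = Poly_Mapping.single (Poly_Mapping.single i 1) 1"

definition mvars :: "'a::zero mpoly \<Rightarrow> nat set" where
  "mvars p = (\<Union>m\<in>Poly_Mapping.keys p. Poly_Mapping.keys m)"

definition mpderiv :: "nat \<Rightarrow> 'a::comm_ring_1 mpoly \<Rightarrow> 'a mpoly" where
  "mpderiv i p = (\<Sum>m\<in>Poly_Mapping.keys p.
      Poly_Mapping.single (m - Poly_Mapping.single i 1) (of_nat (Poly_Mapping.lookup m i) * Poly_Mapping.lookup p m))"

definition minsert :: "('a::zero \<Rightarrow> 'b::comm_ring_1) \<Rightarrow> (nat \<Rightarrow> 'b) \<Rightarrow> 'a mpoly \<Rightarrow> 'b" where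
  "minsert phi f p = (\<Sum>m\<in>Poly_Mapping.keys p. phi (Poly_Mapping.lookup p m) * (\<Prod>i\<in>Poly_Mapping.keys m. f i ^ Poly_Mapping.lookup m i))"

definition msubst :: "(nat \<Rightarrow> 'a::comm_ring_1 mpoly) \<Rightarrow> 'a mpoly \<Rightarrow> 'a mpoly" where
  "msubst f p = minsert mconst f p"

definition to_ff :: "'a::idom mpoly \<Rightarrow> 'a mpoly fract" where
  "to_ff p = Fract p 1"

definition alg_indep :: "'a::field mpoly fract list \<Rightarrow> bool" where
  "alg_indep xs \<longleftrightarrow> distinct xs \<and>
     (\<forall>P :: 'a mpoly. mvars P \<subseteq> {..<length xs} \<longrightarrow>
        minsert (\<lambda>c. to_ff (mconst c)) (\<lambda>i. if i < length xs then xs ! i else 0) P = 0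
        \<longrightarrow> P = 0)"

definition gen_field :: "nat \<Rightarrow> (nat \<Rightarrow> 'a::field mpoly) \<Rightarrow> 'a mpoly fract set" where
  "gen_field m g = (let gf = (\<lambda>i. if i < m then to_ff (g i) else 0);
                        ev = minsert (\<lambda>c. to_ff (mconst c)) gf
                    in {ev p / ev q | p q. ev q \<noteq> 0})"

definition trdeg :: "nat \<Rightarrow> (nat \<Rightarrow> 'a::field mpoly) \<Rightarrow> enat" where
  "trdeg m g = (SUP xs \<in> {xs. set xs \<subseteq> gen_field m g \<and> alg_indep xs}. enat (length xs))"

definition lin_subst :: "nat \<Rightarrow> nat \<Rightarrow> (nat \<Rightarrow> nat \<Rightarrow> 'a::comm_ring_1) \<Rightarrow> nat \<Rightarrow> 'a mpoly" where
  "lin_subst N n C k = (if k < N then (\<Sum>l<n. mconst (C k l) * mvar l) else 0)"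

definition dB_paired ::
  "nat \<Rightarrow> nat \<Rightarrow> nat \<Rightarrow> nat \<Rightarrow> (nat \<Rightarrow> 'a::field mpoly) \<Rightarrow> (nat \<Rightarrow> 'a mpoly)
   \<Rightarrow> (nat \<Rightarrow> nat \<Rightarrow> 'a) \<Rightarrow> (nat \<Rightarrow> nat \<Rightarrow> 'a) \<Rightarrow> bool" where
  "dB_paired m n M N g G B C \<longleftrightarrow>
     (\<forall>i<m. mvars (g i) \<subseteq> {..<n}) \<and> (\<forall>j<M. mvars (G j) \<subseteq> {..<N}) \<and>
     (\<forall>i<m. g i = (\<Sum>j<M. mconst (B i j) * msubst (lin_subst N n C) (G j))) \<and>
     trdeg m g = trdeg M G"

definition sym_dB_paired ::
  "nat \<Rightarrow> nat \<Rightarrow> (nat \<Rightarrow> 'a::field mpoly) \<Rightarrow> (nat \<Rightarrow> 'a mpoly) \<Rightarrow> (nat \<Rightarrow> nat \<Rightarrow> 'a) \<Rightarrow> bool" where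
  "sym_dB_paired n N g G C \<longleftrightarrow> dB_paired n n N N g G (\<lambda>i j. C j i) C"

definition grad :: "'a::comm_ring_1 mpoly \<Rightarrow> nat \<Rightarrow> 'a mpoly" where
  "grad h k = mpderiv k h"

definition hessian :: "'a::comm_ring_1 mpoly \<Rightarrow> nat \<Rightarrow> nat \<Rightarrow> 'a mpoly" where
  "hessian h i j = mpderiv i (mpderiv j h)"

text \<open>The matrix C \<in> Mat_{N,n}(K) with C^t = diag(I_{n-1}, (c_n ... c_N)) (0-indexed:
  rows k < n-1 are unit vectors e_k, rows k \<ge> n-1 are c k \<cdot> e_{n-1}).\<close>
definition Cmat :: "nat \<Rightarrow> (nat \<Rightarrow> 'a::zero_neq_one) \<Rightarrow> nat \<Rightarrow> nat \<Rightarrow> 'a" where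
  "Cmat n c k l = (if k < n - 1 then (if l = k then 1 else 0)
                   else (if l = n - 1 then c k else 0))"

end

theory Submission
  imports Defs "HOL-Library.FuncSet" "HOL-Computational_Algebra.Polynomial"
begin

text \<open>In characteristic zero the transcendence degree of \<open>K(g)\<close> is the rank of the Jacobian of \<open>g\<close>. Let \<open>r\<close> be
  the rank of the Hessian \<open>H\<close> of \<open>h\<close>, and \<open>S\<close> a set of \<open>r\<close> independent rows among the first \<open>n - 1\<close>.
  By symmetry of \<open>H\<close> the principal minor on \<open>S\<close> is nonsingular. The Jacobian of
  \<open>g = C\<^sup>t (\<nabla>h)(Cx)\<close> is \<open>C\<^sup>t H(Cx) C\<close>. For generic \<open>c\<close> the substitution of \<open>Cx\<close> preserves both the
  nonsingular minor, which \<open>C\<close> leaves in place, and the dependence of all rows on those in \<open>S\<close>, so this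
  matrix has rank \<open>r\<close> as well.\<close>

section \<open>Evaluation and differentiation of multivariate polynomials\<close>

text \<open>The obstacle is that Cx cannot be substituted into rational functions: a denominator may
  vanish identically on the image. The rank is therefore witnessed by polynomial identities. The
  coefficients expressing all rows of H by those in \<open>S\<close>, and the inverse of the
  principal minor, are written over common denominators \<open>q1\<close> and \<open>q2\<close>;
  every ring homomorphism transports the cleared identities, and they remain meaningful as long as
  the images of \<open>q1\<close> and \<open>q2\<close> are nonzero. Genericity of \<open>c\<close>
  thus means only that \<open>q1\<close>, \<open>q2\<close> and the last coordinates do not vanish
  at the point \<open>c\<close>, and this suffices because \<open>c\<close> itself lies in the image
  of Cx. In the Jacobian criterion the delicate direction is that independent functions have
  independent differentials. It rests on the fact that M variables admit at most M algebraically
  independent rational functions, obtained by counting monomials.\<close>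

lemma poly_mapping_decompose:
  fixes p :: "'b \<Rightarrow>\<^sub>0 'c::comm_monoid_add"
  shows "p = (\<Sum>m\<in>Poly_Mapping.keys p. Poly_Mapping.single m (Poly_Mapping.lookup p m))"
proof (rule poly_mapping_eqI)
  fix k
  show "Poly_Mapping.lookup p k = Poly_Mapping.lookup
      (\<Sum>m\<in>Poly_Mapping.keys p. Poly_Mapping.single m (Poly_Mapping.lookup p m)) k"
    by (auto simp: lookup_sum lookup_single when_def sum.delta in_keys_iff)
qed

lemma poly_mapping_add_induct [case_names single add]:
  fixes p :: "'b \<Rightarrow>\<^sub>0 'c::comm_monoid_add"
  assumes single: "\<And>m c. P (Poly_Mapping.single m c)"
    and add: "\<And>p q. P p \<Longrightarrow> P q \<Longrightarrow> P (p + q)"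
  shows "P p"
proof -
  have "finite A \<Longrightarrow> P (\<Sum>m\<in>A. Poly_Mapping.single m (Poly_Mapping.lookup p m))" for A
  proof (induction A rule: finite_induct)
    case empty
    show ?case using single[of undefined 0] by simp
  qed (simp add: single add)
  then show ?thesis
    using poly_mapping_decompose[of p] by (metis finite_keys)
qed

text \<open>Evaluation at points, on lines, by substitution and in the function field differ only in
  the map on coefficients, so their laws are proved once.\<close>

locale coeff_hom =
  fixes phi :: "'a::comm_ring_1 \<Rightarrow> 'b::comm_ring_1"
  assumes hom_one: "phi 1 = 1"
    and hom_add: "phi (a + b) = phi a + phi b"
    and hom_mult: "phi (a * b) = phi a * phi b"
begin

lemma hom_zero: "phi 0 = 0"
  using hom_add[of 0 0] by simp

lemma minsert_single:
  "minsert phi f (Poly_Mapping.single m c) =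
     phi c * (\<Prod>i\<in>Poly_Mapping.keys m. f i ^ Poly_Mapping.lookup m i)"
  by (simp add: minsert_def hom_zero)

lemma minsert_zero [simp]: "minsert phi f 0 = 0"
  by (simp add: minsert_def)

lemma minsert_add: "minsert phi f (p + q) = minsert phi f p + minsert phi f q"
  unfolding minsert_def
  by (rule setsum_keys_plus_distrib[where
        f = "\<lambda>m c. phi c * (\<Prod>i\<in>Poly_Mapping.keys m. f i ^ Poly_Mapping.lookup m i)"])
     (simp_all add: hom_zero hom_add distrib_right)

lemma minsert_mconst: "minsert phi f (mconst c) = phi c"
  by (simp add: mconst_def minsert_single)

lemma minsert_one [simp]: "minsert phi f 1 = 1"
  using minsert_mconst[of f 1] by (simp add: mconst_def hom_one)

lemma minsert_mvar: "minsert phi f (mvar i) = f i"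
  by (simp add: mvar_def minsert_single hom_one)

lemma minsert_mult: "minsert phi f (p * q) = minsert phi f p * minsert phi f q"
proof (induction p rule: poly_mapping_add_induct)
  case (single m c)
  show ?case
  proof (induction q rule: poly_mapping_add_induct)
    case (single m' c')
    let ?M = "\<lambda>m. \<Prod>i\<in>Poly_Mapping.keys m. f i ^ Poly_Mapping.lookup m i"
    let ?K = "Poly_Mapping.keys m \<union> Poly_Mapping.keys m'"
    have *: "?M k = (\<Prod>i\<in>?K. f i ^ Poly_Mapping.lookup k i)"
      if "Poly_Mapping.keys k \<subseteq> ?K" for k
      by (rule prod.mono_neutral_left) (use that in \<open>auto simp: in_keys_iff\<close>)
    have "?M (m + m') = ?M m * ?M m'"
      unfolding *[OF keys_add] *[OF Un_upper1] *[OF Un_upper2]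
      by (simp add: lookup_add power_add prod.distrib)
    then show ?case
      by (simp add: mult_single minsert_single hom_mult ac_simps)
  qed (simp_all add: distrib_left minsert_add)
qed (simp_all add: distrib_right minsert_add)

lemma minsert_sum: "minsert phi f (\<Sum>i\<in>A. p i) = (\<Sum>i\<in>A. minsert phi f (p i))"
  by (induction A rule: infinite_finite_induct) (simp_all add: minsert_add)

lemma minsert_prod: "minsert phi f (\<Prod>i\<in>A. p i) = (\<Prod>i\<in>A. minsert phi f (p i))"
  by (induction A rule: infinite_finite_induct) (simp_all add: minsert_mult)

lemma minsert_uminus: "minsert phi f (- p) = - minsert phi f p"
  using minsert_add[of f p "- p"] by (simp add: eq_neg_iff_add_eq_0 add.commute)

lemma minsert_diff: "minsert phi f (p - q) = minsert phi f p - minsert phi f q"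
  using minsert_add[of f p "- q"] by (simp add: minsert_uminus)

end

lemma minsert_cong:
  assumes "\<And>i. i \<in> mvars p \<Longrightarrow> f i = g i"
  shows "minsert phi f p = minsert phi g p"
  unfolding minsert_def
  by (intro sum.cong prod.cong refl arg_cong2[where f = "(*)"])
     (use assms in \<open>auto simp: mvars_def intro!: arg_cong2[where f = "(^)"]\<close>)

lemma mconst_add: "mconst (a + b) = mconst a + mconst b"
  by (simp add: mconst_def single_add)

lemma mconst_mult: "mconst (a * b) = mconst a * mconst b"
  by (simp add: mconst_def mult_single)

lemma mconst_one [simp]: "mconst 1 = 1"
  by (simp add: mconst_def)

lemma mconst_zero [simp]: "mconst 0 = 0"
  by (simp add: mconst_def)

lemma single_eq_mconst_prod:
  "Poly_Mapping.single m c = mconst c * (\<Prod>i\<in>Poly_Mapping.keys m. mvar i ^ Poly_Mapping.lookup m i)"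
proof -
  have pow: "mvar i ^ k = (Poly_Mapping.single (Poly_Mapping.single i k) 1 :: 'a mpoly)" for i k
    by (induction k) (simp_all add: mvar_def mult_single single_add[symmetric])
  have "(\<Prod>i\<in>A. mvar i ^ Poly_Mapping.lookup m i :: 'a mpoly) =
      Poly_Mapping.single (\<Sum>i\<in>A. Poly_Mapping.single i (Poly_Mapping.lookup m i)) 1" for A
    by (induction A rule: infinite_finite_induct) (simp_all add: pow mult_single)
  then show ?thesis
    using poly_mapping_decompose[of m] by (simp add: mconst_def mult_single)
qed

lemma mpoly_induct [case_names const var add mult]:
  assumes const: "\<And>c. P (mconst c)" and var: "\<And>i. P (mvar i)"
    and add: "\<And>p q. P p \<Longrightarrow> P q \<Longrightarrow> P (p + q)"
    and mult: "\<And>p q. P p \<Longrightarrow> P q \<Longrightarrow> P (p * q)"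
  shows "P (p :: 'a::comm_ring_1 mpoly)"
proof (induction p rule: poly_mapping_add_induct)
  case (single m c)
  have one: "P 1" using const[of 1] by simp
  have pow: "P (mvar i ^ k)" for i k
    by (induction k) (simp_all add: one var mult)
  have "P (\<Prod>i\<in>A. mvar i ^ Poly_Mapping.lookup m i)" for A
    by (induction A rule: infinite_finite_induct) (simp_all add: one pow mult)
  then show ?case
    unfolding single_eq_mconst_prod by (intro mult const)
qed (rule add)

section \<open>Formal partial derivatives\<close>

lemma mpderiv_add: "mpderiv i (p + q) = mpderiv i p + mpderiv i q"
  unfolding mpderiv_def
  by (rule setsum_keys_plus_distrib[where
        f = "\<lambda>m c. Poly_Mapping.single (m - Poly_Mapping.single i 1) (of_nat (Poly_Mapping.lookup m i) * c)"])
     (simp_all add: single_add[symmetric] distrib_left)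

lemma mpderiv_single:
  "mpderiv i (Poly_Mapping.single m c) =
     Poly_Mapping.single (m - Poly_Mapping.single i 1) (of_nat (Poly_Mapping.lookup m i) * c)"
  by (simp add: mpderiv_def)

lemma mpderiv_mconst [simp]: "mpderiv i (mconst c) = 0"
  by (simp add: mconst_def mpderiv_single)

lemma mpderiv_one [simp]: "mpderiv i 1 = 0"
  using mpderiv_mconst[of i 1] by simp

lemma mpderiv_mvar: "mpderiv i (mvar j) = (if i = j then 1 else 0)"
  by (simp add: mvar_def mpderiv_single lookup_single when_def)

lemma mpderiv_mult: "mpderiv i (p * q) = mpderiv i p * q + p * mpderiv i q"
proof (induction p rule: poly_mapping_add_induct)
  case (single m c)
  show ?case
  proof (induction q rule: poly_mapping_add_induct)
    case (single m' c')
    let ?e = "Poly_Mapping.single i (1::nat)"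
    let ?k = "m + m' - ?e"
    \<comment> \<open>Subtraction of exponents is truncated, so the two exponent vectors may differ;
      this happens only when \<open>k\<close> does not involve the variable \<open>i\<close>, and
      then the coefficient is 0.\<close>
    have left: "Poly_Mapping.single (k - ?e + k') (of_nat (Poly_Mapping.lookup k i) * b) =
        Poly_Mapping.single (k + k' - ?e) (of_nat (Poly_Mapping.lookup k i) * b)"
      for k k' :: "nat \<Rightarrow>\<^sub>0 nat" and b :: 'a
    proof (cases "Poly_Mapping.lookup k i = 0")
      case False
      then have "k - ?e + k' = k + k' - ?e"
        by (intro poly_mapping_eqI) (auto simp: lookup_add lookup_minus lookup_single when_def)
      then show ?thesis by simp
    qed simp
    have "mpderiv i (Poly_Mapping.single m c * Poly_Mapping.single m' c') =
        Poly_Mapping.single ?k (of_nat (Poly_Mapping.lookup m i) * (c * c')) +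
        Poly_Mapping.single ?k (of_nat (Poly_Mapping.lookup m' i) * (c * c'))"
      by (simp add: mult_single mpderiv_single lookup_add single_add[symmetric] algebra_simps)
    also have "\<dots> = mpderiv i (Poly_Mapping.single m c) * Poly_Mapping.single m' c'
        + Poly_Mapping.single m c * mpderiv i (Poly_Mapping.single m' c')"
      using left[of m m' "c * c'"] left[of m' m "c * c'"]
      by (simp add: mult_single mpderiv_single ac_simps)
    finally show ?case .
  qed (simp_all add: algebra_simps mpderiv_add)
qed (simp_all add: algebra_simps mpderiv_add)

lemma mpderiv_zero [simp]: "mpderiv i 0 = 0"
  by (simp add: mpderiv_def)

lemma mpderiv_sum: "mpderiv i (\<Sum>j\<in>A. p j) = (\<Sum>j\<in>A. mpderiv i (p j))"
  by (induction A rule: infinite_finite_induct) (simp_all add: mpderiv_add)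

lemma mpderiv_commute: "mpderiv i (mpderiv j p) = mpderiv j (mpderiv i p)"
  by (induction p rule: mpoly_induct)
     (simp_all add: mpderiv_mvar mpderiv_add mpderiv_mult algebra_simps)

locale coeff_derivation = coeff_hom phi
  for phi :: "'a::comm_ring_1 \<Rightarrow> 'b::comm_ring_1" +
  fixes delta :: "'b \<Rightarrow> 'b"
  assumes deriv_add: "delta (x + y) = delta x + delta y"
    and deriv_mult: "delta (x * y) = delta x * y + x * delta y"
    and deriv_const: "delta (phi c) = 0"
begin

text \<open>The chain rule. Both sides are additive and obey the Leibniz rule in \<open>p\<close>,
  so constants and variables suffice. The set \<open>S\<close> keeps the sum finite without bounding
  the variables of \<open>p\<close>.\<close>

lemma deriv_minsert:
  assumes "finite S" and "\<And>j. j \<notin> S \<Longrightarrow> delta (f j) = 0"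
  shows "delta (minsert phi f p) = (\<Sum>j\<in>S. minsert phi f (mpderiv j p) * delta (f j))"
proof (induction p rule: mpoly_induct)
  case (const c)
  show ?case by (simp add: minsert_mconst deriv_const)
next
  case (var i)
  have "(\<Sum>j\<in>S. minsert phi f (mpderiv j (mvar i)) * delta (f j)) =
      (\<Sum>j\<in>S. if i = j then delta (f j) else 0)"
    by (intro sum.cong) (auto simp: mpderiv_mvar)
  then show ?case
    using assms by (auto simp: minsert_mvar sum.delta')
next
  case (add p q)
  then show ?case
    by (simp add: minsert_add mpderiv_add deriv_add distrib_right sum.distrib)
next
  case (mult p q)
  then show ?case
    by (simp add: minsert_mult minsert_add mpderiv_mult deriv_mult sum.distrib
        sum_distrib_left sum_distrib_right algebra_simps)
qed

end

lemma minsert_hom_comp: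
  assumes "coeff_hom phi" "coeff_hom psi"
  shows "psi (minsert phi f p) = minsert (\<lambda>c. psi (phi c)) (\<lambda>i. psi (f i)) p"
proof -
  interpret phi: coeff_hom phi by fact
  interpret psi: coeff_hom psi by fact
  interpret comp: coeff_hom "\<lambda>c. psi (phi c)"
    by unfold_locales (simp_all add: phi.hom_one psi.hom_one phi.hom_add psi.hom_add
        phi.hom_mult psi.hom_mult)
  show ?thesis
    by (induction p rule: mpoly_induct)
       (simp_all add: phi.minsert_mconst comp.minsert_mconst phi.minsert_mvar comp.minsert_mvar
          phi.minsert_add comp.minsert_add phi.minsert_mult comp.minsert_mult
          psi.hom_add psi.hom_mult)
qed

lemma coeff_hom_id: "coeff_hom (\<lambda>c. c)"
  by unfold_locales simp_all

lemma coeff_hom_mconst: "coeff_hom mconst"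
  by unfold_locales (simp_all add: mconst_add mconst_mult)

interpretation subst: coeff_derivation mconst "mpderiv i" for i
  by unfold_locales (simp_all add: mconst_add mconst_mult mpderiv_add mpderiv_mult)

subsection \<open>Variables and degrees\<close>

lemma mvars_add: "mvars (p + q) \<subseteq> mvars p \<union> mvars q"
  using keys_add[of p q] by (auto simp: mvars_def)

lemma mvars_mult: "mvars (p * q) \<subseteq> mvars p \<union> mvars q"
proof
  fix i assume "i \<in> mvars (p * q)"
  then obtain a b where "a \<in> Poly_Mapping.keys p" "b \<in> Poly_Mapping.keys q"
    "i \<in> Poly_Mapping.keys (a + b)"
    using keys_mult[of p q] by (auto simp: mvars_def)
  then show "i \<in> mvars p \<union> mvars q"
    using keys_add[of a b] by (auto simp: mvars_def)
qed

lemma mvars_zero [simp]: "mvars 0 = {}"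
  by (simp add: mvars_def)

lemma mvars_mconst [simp]: "mvars (mconst c) = {}"
  by (simp add: mvars_def mconst_def)

lemma mvars_one [simp]: "mvars (1 :: 'a::comm_ring_1 mpoly) = {}"
  by (simp add: mvars_def)

lemma mvars_mvar [simp]: "mvars (mvar i :: 'a::comm_ring_1 mpoly) = {i}"
  by (simp add: mvars_def mvar_def)

lemma mvars_sum: "(\<And>i. i \<in> A \<Longrightarrow> mvars (p i) \<subseteq> V) \<Longrightarrow> mvars (\<Sum>i\<in>A. p i) \<subseteq> V"
proof (induction A rule: infinite_finite_induct)
  case (insert x F)
  then show ?case using mvars_add[of "p x" "sum p F"] by fastforce
qed simp_all

lemma mvars_prod:
  "(\<And>i. i \<in> A \<Longrightarrow> mvars (p i) \<subseteq> V) \<Longrightarrow> mvars (\<Prod>i\<in>A. p i :: 'a::comm_ring_1 mpoly) \<subseteq> V"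
proof (induction A rule: infinite_finite_induct)
  case (insert x F)
  then show ?case using mvars_mult[of "p x" "prod p F"] by fastforce
qed simp_all

lemma mvars_power: "mvars (p :: 'a::comm_ring_1 mpoly) \<subseteq> V \<Longrightarrow> mvars (p ^ k) \<subseteq> V"
  using mvars_prod[of "{..<k}" "\<lambda>_. p" V] by simp

lemma mvars_diff: "mvars (p - q) \<subseteq> mvars p \<union> mvars q"
  for p q :: "'a::comm_ring_1 mpoly"
  using keys_diff[of p q] by (auto simp: mvars_def)

lemma mvars_minsert:
  assumes "\<And>i. i \<in> mvars p \<Longrightarrow> mvars (f i) \<subseteq> V"
  shows "mvars (minsert mconst f p) \<subseteq> V"
proof -
  have "mvars (\<Prod>i\<in>Poly_Mapping.keys m. f i ^ Poly_Mapping.lookup m i) \<subseteq> V"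
    if "m \<in> Poly_Mapping.keys p" for m
    by (intro mvars_prod mvars_power assms) (use that in \<open>auto simp: mvars_def\<close>)
  then show ?thesis
    unfolding minsert_def by (intro mvars_sum order.trans[OF mvars_mult]) simp
qed

lemma keys_mpderiv:
  assumes "k \<in> Poly_Mapping.keys (mpderiv i p)"
  obtains m where "m \<in> Poly_Mapping.keys p" "i \<in> Poly_Mapping.keys m"
    "k = m - Poly_Mapping.single i 1"
proof -
  obtain m where m: "m \<in> Poly_Mapping.keys p" and k: "k \<in> Poly_Mapping.keys
      (Poly_Mapping.single (m - Poly_Mapping.single i 1) (of_nat (Poly_Mapping.lookup m i) * Poly_Mapping.lookup p m))"
    using subsetD[OF keys_sum assms[unfolded mpderiv_def]] by (rule UN_E)
  have "of_nat (Poly_Mapping.lookup m i) * Poly_Mapping.lookup p m \<noteq> 0"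
    using k by (auto split: if_splits)
  then have "Poly_Mapping.lookup m i \<noteq> 0"
    by (intro notI) simp
  then show thesis
    using that m k by (auto simp: in_keys_iff split: if_splits)
qed

lemma mvars_mpderiv: "mvars (mpderiv i p) \<subseteq> mvars p"
proof
  fix j assume "j \<in> mvars (mpderiv i p)"
  then obtain k where "k \<in> Poly_Mapping.keys (mpderiv i p)" "j \<in> Poly_Mapping.keys k"
    by (auto simp: mvars_def)
  then obtain m where "m \<in> Poly_Mapping.keys p" "j \<in> Poly_Mapping.keys (m - Poly_Mapping.single i 1)"
    by (auto elim: keys_mpderiv)
  then show "j \<in> mvars p"
    by (force simp: mvars_def in_keys_iff lookup_minus)
qed

lemma lookup_mpderiv:
  "Poly_Mapping.lookup (mpderiv i p) k =
     of_nat (Suc (Poly_Mapping.lookup k i)) * Poly_Mapping.lookup p (k + Poly_Mapping.single i 1)"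
proof (induction p rule: poly_mapping_add_induct)
  case (single m c)
  let ?e = "Poly_Mapping.single i (1::nat)"
  show ?case
  proof (cases "Poly_Mapping.lookup m i = 0")
    case True
    then have "m \<noteq> k + ?e" by (auto simp: lookup_add)
    with True show ?thesis by (simp add: mpderiv_single lookup_single when_def)
  next
    case False
    then have "m - ?e + ?e = m"
      by (intro poly_mapping_eqI) (auto simp: lookup_add lookup_minus lookup_single when_def)
    then have "m - ?e = k \<longleftrightarrow> m = k + ?e" by auto
    then show ?thesis
      by (auto simp: mpderiv_single lookup_single when_def lookup_add)
  qed
qed (simp_all add: mpderiv_add lookup_add algebra_simps)

text \<open>Characteristic zero enters here: differentiation multiplies the coefficient of each
  monomial containing the variable by a positive integer, and distinct such monomials stay
  distinct.\<close>

lemma mpderiv_eq_0_imp_not_mvars: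
  fixes p :: "'a::field_char_0 mpoly"
  assumes "mpderiv i p = 0"
  shows "i \<notin> mvars p"
proof
  let ?e = "Poly_Mapping.single i (1::nat)"
  assume "i \<in> mvars p"
  then obtain m where m: "m \<in> Poly_Mapping.keys p" "i \<in> Poly_Mapping.keys m"
    by (auto simp: mvars_def)
  have "m - ?e + ?e = m"
    using m(2) by (intro poly_mapping_eqI)
      (auto simp: lookup_add lookup_minus lookup_single when_def in_keys_iff)
  then have "of_nat (Suc (Poly_Mapping.lookup (m - ?e) i)) * Poly_Mapping.lookup p m = 0"
    using lookup_mpderiv[of i p "m - ?e"] assms by simp
  then show False
    using m(1) by (simp add: in_keys_iff del: of_nat_Suc)
qed

lemma mvars_empty_imp_const:
  assumes "mvars p = {}"
  shows "p = mconst (Poly_Mapping.lookup p 0)"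
proof (rule poly_mapping_eqI)
  fix k
  have "k = 0" if "k \<in> Poly_Mapping.keys p"
    using assms that by (simp add: mvars_def keys_eq_empty)
  then show "Poly_Mapping.lookup p k = Poly_Mapping.lookup (mconst (Poly_Mapping.lookup p 0)) k"
    by (auto simp: mconst_def lookup_single when_def in_keys_iff)
qed

text \<open>Descents below differentiate, which lowers the total degree. A bound instead of the
  degree itself needs no convention for the zero polynomial.\<close>

definition deg_le :: "nat \<Rightarrow> 'a::zero mpoly \<Rightarrow> bool" where
  "deg_le d p \<longleftrightarrow> (\<forall>m\<in>Poly_Mapping.keys p. (\<Sum>i\<in>Poly_Mapping.keys m. Poly_Mapping.lookup m i) \<le> d)"

lemma ex_deg_le: "\<exists>d. deg_le d p"
proof -
  let ?g = "\<lambda>m. \<Sum>i\<in>Poly_Mapping.keys m. Poly_Mapping.lookup m i"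
  have "deg_le (Max (?g ` Poly_Mapping.keys p)) p"
    unfolding deg_le_def by (intro ballI Max_ge) auto
  then show ?thesis ..
qed

lemma deg_le_0_imp_const:
  assumes "deg_le 0 p"
  shows "mvars p = {}"
proof -
  have "i \<notin> Poly_Mapping.keys m" if "m \<in> Poly_Mapping.keys p" for m i
    using assms that by (auto simp: deg_le_def in_keys_iff)
  then show ?thesis unfolding mvars_def by blast
qed

lemma deg_le_mpderiv:
  assumes "deg_le (Suc d) p"
  shows "deg_le d (mpderiv i p)"
  unfolding deg_le_def
proof
  fix k assume "k \<in> Poly_Mapping.keys (mpderiv i p)"
  then obtain m where m: "m \<in> Poly_Mapping.keys p" "i \<in> Poly_Mapping.keys m"
    and k: "k = m - Poly_Mapping.single i 1"
    by (rule keys_mpderiv)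
  have "(\<Sum>j\<in>Poly_Mapping.keys k. Poly_Mapping.lookup k j) =
      (\<Sum>j\<in>Poly_Mapping.keys m. Poly_Mapping.lookup k j)"
    by (rule sum.mono_neutral_left) (auto simp: k in_keys_iff lookup_minus)
  also have "\<dots> < (\<Sum>j\<in>Poly_Mapping.keys m. Poly_Mapping.lookup m j)"
    using m(2) by (intro sum_strict_mono_ex1)
      (auto simp: k lookup_minus in_keys_iff intro!: exI[of _ i] bexI[of _ i])
  also have "\<dots> \<le> Suc d"
    using assms m(1) by (simp add: deg_le_def)
  finally show "(\<Sum>j\<in>Poly_Mapping.keys k. Poly_Mapping.lookup k j) \<le> d" by simp
qed

subsection \<open>Points where a polynomial does not vanish\<close>

text \<open>If a polynomial vanishes at all points, so do its partial derivatives, as one sees on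
  lines parallel to the axes; descend on the degree.\<close>

lemma vanishing_everywhere_imp_zero:
  fixes p :: "'a::field_char_0 mpoly"
  assumes "\<And>c. minsert (\<lambda>a. a) c p = 0"
  shows "p = 0"
proof -
  interpret ev: coeff_hom "\<lambda>a::'a. a" by (rule coeff_hom_id)
  interpret line: coeff_derivation "\<lambda>a::'a. [:a:]" pderiv
    by unfold_locales (simp_all add: pderiv_add pderiv_mult pderiv_pCons one_pCons algebra_simps)
  have deriv: "minsert (\<lambda>a. a) c (mpderiv i p) = 0" if p: "\<And>c. minsert (\<lambda>a. a) c p = 0"
    for c i and p :: "'a mpoly"
  proof -
    define L where "L = (\<lambda>j. if j = i then [:0, 1:] else [:c j:])"
    have poly: "poly (minsert (\<lambda>a. [:a:]) L q) t = minsert (\<lambda>a. a) (c(i := t)) q" for q t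
    proof -
      have "coeff_hom (\<lambda>q. poly q t)" by unfold_locales simp_all
      then have "poly (minsert (\<lambda>a. [:a:]) L q) t = minsert (\<lambda>a. a) (\<lambda>j. poly (L j) t) q"
        by (subst minsert_hom_comp[OF line.coeff_hom_axioms, of "\<lambda>q. poly q t"]) simp_all
      also have "(\<lambda>j. poly (L j) t) = c(i := t)" by (auto simp: L_def)
      finally show ?thesis .
    qed
    \<comment> \<open>The field is infinite, so a univariate polynomial vanishing at every point is
      zero.\<close>
    have "minsert (\<lambda>a. [:a:]) L p = 0"
      using poly[of p] p by (simp add: poly_all_0_iff_0[symmetric])
    moreover have "pderiv (minsert (\<lambda>a. [:a:]) L p) =
        (\<Sum>j\<in>{i}. minsert (\<lambda>a. [:a:]) L (mpderiv j p) * pderiv (L j))"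
      by (rule line.deriv_minsert) (simp_all add: L_def)
    ultimately have "minsert (\<lambda>a. [:a:]) L (mpderiv i p) = 0"
      by (simp add: L_def pderiv_pCons)
    then show ?thesis
      using poly[of "mpderiv i p" "c i"] by simp
  qed
  have "p = 0" if "deg_le d p" "\<And>c. minsert (\<lambda>a. a) c p = 0" for d and p :: "'a mpoly"
    using that
  proof (induction d arbitrary: p)
    case 0
    then have "p = mconst (Poly_Mapping.lookup p 0)"
      by (intro mvars_empty_imp_const deg_le_0_imp_const)
    then show ?case using "0.prems"(2) by (metis ev.minsert_mconst mconst_zero)
  next
    case (Suc d)
    have "mpderiv i p = 0" for i
      using Suc deriv by (intro Suc.IH deg_le_mpderiv) auto
    then have "p = mconst (Poly_Mapping.lookup p 0)"
      by (intro mvars_empty_imp_const) (auto dest: mpderiv_eq_0_imp_not_mvars)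
    then show ?case using Suc.prems(2) by (metis ev.minsert_mconst mconst_zero)
  qed
  then show ?thesis using assms ex_deg_le by blast
qed

section \<open>Linear systems\<close>

text \<open>Elimination: an equation with a nonzero coefficient disappears together with one unknown
  \<open>i0\<close>, and an equation without one is dropped, so the unknowns keep outnumbering the
  equations.\<close>

lemma homogeneous_system_solution:
  fixes A :: "'i \<Rightarrow> 'j \<Rightarrow> 'k::field"
  assumes "finite J" "finite I" "card J < card I"
  shows "\<exists>a. (\<exists>i\<in>I. a i \<noteq> 0) \<and> (\<forall>j\<in>J. (\<Sum>i\<in>I. a i * A i j) = 0)"
  using assms
proof (induction J arbitrary: I A rule: finite_induct)
  case empty
  then have "I \<noteq> {}" by auto
  then show ?case by (intro exI[of _ "\<lambda>_. 1"]) auto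
next
  case (insert j J)
  show ?case
  proof (cases "\<forall>i\<in>I. A i j = 0")
    case True
    obtain a where "\<exists>i\<in>I. a i \<noteq> 0" "\<forall>k\<in>J. (\<Sum>i\<in>I. a i * A i k) = 0"
      using insert.IH[of I A] insert.prems insert.hyps by auto
    with True show ?thesis by (intro exI[of _ a]) auto
  next
    case False
    then obtain i0 where i0: "i0 \<in> I" "A i0 j \<noteq> 0" by auto
    define I' where "I' = I - {i0}"
    have I': "finite I'" "card J < card I'" "i0 \<notin> I'" "I = insert i0 I'"
      using insert.prems insert.hyps i0 by (auto simp: I'_def card_Diff_singleton)
    obtain a where a: "\<exists>i\<in>I'. a i \<noteq> 0"
      "\<And>k. k \<in> J \<Longrightarrow> (\<Sum>i\<in>I'. a i * (A i k - A i j / A i0 j * A i0 k)) = 0"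
      using insert.IH[OF I'(1,2), of "\<lambda>i k. A i k - A i j / A i0 j * A i0 k"] by auto
    \<comment> \<open>The pivot unknown takes the value that makes equation \<open>j\<close> hold;
      inserting this value into the other equations yields the reduced system that \<open>a\<close>
      solves.\<close>
    define b where "b = a(i0 := - (\<Sum>i\<in>I'. a i * A i j) / A i0 j)"
    have "(\<Sum>i\<in>I. b i * A i k) = 0" if "k \<in> insert j J" for k
    proof -
      have scale: "(\<Sum>i\<in>I'. a i * (A i j / A i0 j * A i0 k)) = (\<Sum>i\<in>I'. a i * A i j) / A i0 j * A i0 k"
        by (simp add: sum_distrib_right sum_divide_distrib mult.assoc)
      have "(\<Sum>i\<in>I. b i * A i k) = b i0 * A i0 k + (\<Sum>i\<in>I'. a i * A i k)"
        using I' by (auto simp: b_def intro!: sum.cong)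
      also have "\<dots> = (\<Sum>i\<in>I'. a i * (A i k - A i j / A i0 j * A i0 k))"
        by (simp add: b_def right_diff_distrib sum_subtractf scale del: times_divide_eq_right times_divide_eq_left)
      also have "\<dots> = 0"
        using that a(2) i0(2) by (cases "k = j") auto
      finally show ?thesis .
    qed
    moreover have "\<exists>i\<in>I. b i \<noteq> 0"
      using a(1) I' by (auto simp: b_def)
    ultimately show ?thesis by blast
  qed
qed

section \<open>The derivations of the rational function field\<close>

lemma to_ff_simps [simp]:
  "to_ff (p + q) = to_ff p + to_ff q"
  "to_ff (p * q) = to_ff p * to_ff q"
  "to_ff 0 = 0"
  "to_ff 1 = 1"
  by (simp_all add: to_ff_def fract_collapse)

lemma to_ff_eq_iff [simp]: "to_ff p = to_ff q \<longleftrightarrow> p = q"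
  by (simp add: to_ff_def eq_fract(1))

lemma to_ff_eq_0_iff [simp]: "to_ff p = 0 \<longleftrightarrow> p = 0"
  using to_ff_eq_iff[of p 0] by (simp del: to_ff_eq_iff)

lemma to_ff_sum: "to_ff (\<Sum>i\<in>A. p i) = (\<Sum>i\<in>A. to_ff (p i))"
  by (induction A rule: infinite_finite_induct) simp_all

lemma to_ff_prod: "to_ff (\<Prod>i\<in>A. p i) = (\<Prod>i\<in>A. to_ff (p i))"
  by (induction A rule: infinite_finite_induct) simp_all

lemma to_ff_power: "to_ff (p ^ k) = to_ff p ^ k"
  by (induction k) simp_all

text \<open>The quotient rule. Differentiating \<open>a * d = c * b\<close> shows that the result
  does not depend on the representative.\<close>

lift_definition ffderiv :: "nat \<Rightarrow> 'a::idom mpoly fract \<Rightarrow> 'a mpoly fract" is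
  "\<lambda>i x. (mpderiv i (fst x) * snd x - fst x * mpderiv i (snd x), snd x * snd x)"
proof -
  fix i and x y :: "'a mpoly \<times> 'a mpoly"
  assume "fractrel x y"
  then obtain a b c d where xy: "x = (a, b)" "y = (c, d)" "b \<noteq> 0" "d \<noteq> 0" "a * d = c * b"
    by (cases x, cases y) auto
  have "mpderiv i (a * d) = mpderiv i (c * b)" using xy by simp
  then have "mpderiv i a * d + a * mpderiv i d = mpderiv i c * b + c * mpderiv i b"
    by (simp add: mpderiv_mult)
  then have "(mpderiv i a * b - a * mpderiv i b) * (d * d) =
      (mpderiv i c * d - c * mpderiv i d) * (b * b)"
    using xy(5) by algebra
  then show "fractrel (mpderiv i (fst x) * snd x - fst x * mpderiv i (snd x), snd x * snd x)
      (mpderiv i (fst y) * snd y - fst y * mpderiv i (snd y), snd y * snd y)"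
    using xy by simp
qed

lemma ffderiv_Fract:
  "b \<noteq> 0 \<Longrightarrow> ffderiv i (Fract a b) = Fract (mpderiv i a * b - a * mpderiv i b) (b * b)"
  by (simp add: Fract.abs_eq ffderiv.abs_eq)

lemma ffderiv_to_ff [simp]: "ffderiv i (to_ff p) = to_ff (mpderiv i p)"
  by (simp add: to_ff_def ffderiv_Fract)

lemma ffderiv_add: "ffderiv i (x + y) = ffderiv i x + ffderiv i y"
proof (cases x; cases y)
  fix a b c d assume x: "x = Fract a b" "b \<noteq> 0" and y: "y = Fract c d" "d \<noteq> 0"
  have "(mpderiv i (a * d + c * b) * (b * d) - (a * d + c * b) * mpderiv i (b * d)) * (b * b * (d * d)) =
      ((mpderiv i a * b - a * mpderiv i b) * (d * d) + (mpderiv i c * d - c * mpderiv i d) * (b * b)) *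
        (b * d * (b * d))"
    unfolding mpderiv_add mpderiv_mult by algebra
  then show ?thesis
    using x y by (simp add: ffderiv_Fract eq_fract(1))
qed

lemma ffderiv_mult: "ffderiv i (x * y) = ffderiv i x * y + x * ffderiv i y"
proof (cases x; cases y)
  fix a b c d assume x: "x = Fract a b" "b \<noteq> 0" and y: "y = Fract c d" "d \<noteq> 0"
  have "mpderiv i (a * c) * (b * d) - a * c * mpderiv i (b * d) =
      (mpderiv i a * b - a * mpderiv i b) * c * d + a * (mpderiv i c * d - c * mpderiv i d) * b"
    unfolding mpderiv_mult by (simp add: algebra_simps)
  then have "(mpderiv i (a * c) * (b * d) - a * c * mpderiv i (b * d)) * (b * b * d * (b * (d * d))) =
      ((mpderiv i a * b - a * mpderiv i b) * c * d + a * (mpderiv i c * d - c * mpderiv i d) * b) *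
        (b * b * d * (b * (d * d)))"
    by (rule arg_cong)
  also have "\<dots> = ((mpderiv i a * b - a * mpderiv i b) * c * (b * (d * d)) +
         a * (mpderiv i c * d - c * mpderiv i d) * (b * b * d)) * (b * d * (b * d))"
    by (simp only: distrib_left distrib_right ac_simps)
  finally show ?thesis
    using x y by (simp add: ffderiv_Fract eq_fract(1))
qed

lemma ffderiv_divide:
  assumes "y \<noteq> 0"
  shows "ffderiv i (x / y) = ffderiv i x / y - x / (y * y) * ffderiv i y"
proof -
  have "ffderiv i x = ffderiv i (x / y * y)" using assms by simp
  also have "\<dots> = ffderiv i (x / y) * y + x / y * ffderiv i y"
    by (rule ffderiv_mult)
  finally show ?thesis using assms by (simp add: field_simps)
qed

abbreviation ffeval :: "(nat \<Rightarrow> 'a::field mpoly fract) \<Rightarrow> 'a mpoly \<Rightarrow> 'a mpoly fract" where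
  "ffeval \<equiv> minsert (\<lambda>c. to_ff (mconst c))"

interpretation ff: coeff_derivation "\<lambda>c::'a::field. to_ff (mconst c)" "ffderiv i" for i
  by unfold_locales (simp_all add: mconst_add mconst_mult ffderiv_add ffderiv_mult)

lemma ffderiv_zero [simp]: "ffderiv i 0 = 0"
  by (metis ffderiv_to_ff mpderiv_zero to_ff_simps(3))

section \<open>Algebraic independence and the Jacobian\<close>

text \<open>Indexed families instead of lists: an element is appended by a function update, and
  distinctness need not be carried along.\<close>

definition alg_indep_fam :: "nat \<Rightarrow> (nat \<Rightarrow> 'a::field mpoly fract) \<Rightarrow> bool" where
  "alg_indep_fam s f \<longleftrightarrow> (\<forall>P. mvars P \<subseteq> {..<s} \<longrightarrow> ffeval f P = 0 \<longrightarrow> P = 0)"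

definition lin_indep :: "'i set \<Rightarrow> 'j set \<Rightarrow> ('i \<Rightarrow> 'j \<Rightarrow> 'k::field) \<Rightarrow> bool" where
  "lin_indep S L v \<longleftrightarrow> (\<forall>a. (\<forall>l\<in>L. (\<Sum>i\<in>S. a i * v i l) = 0) \<longrightarrow> (\<forall>i\<in>S. a i = 0))"

lemma lin_indepD:
  "lin_indep S L v \<Longrightarrow> (\<And>l. l \<in> L \<Longrightarrow> (\<Sum>i\<in>S. a i * v i l) = 0) \<Longrightarrow> i \<in> S \<Longrightarrow> a i = 0"
  unfolding lin_indep_def by blast

lemma alg_indep_fam_cong:
  assumes "\<And>i. i < s \<Longrightarrow> f i = g i"
  shows "alg_indep_fam s f \<longleftrightarrow> alg_indep_fam s g"
proof -
  have "ffeval f P = ffeval g P" if "mvars P \<subseteq> {..<s}" for P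
    by (rule minsert_cong) (use that assms in auto)
  then show ?thesis unfolding alg_indep_fam_def by auto
qed

text \<open>A repeated entry satisfies the relation \<open>mvar i - mvar j\<close>, so independence
  already implies \<open>distinct\<close>.\<close>

lemma alg_indep_iff:
  fixes xs :: "'a::field mpoly fract list"
  shows "alg_indep xs \<longleftrightarrow> alg_indep_fam (length xs) (\<lambda>i. xs ! i)"
proof -
  let ?f = "\<lambda>i. if i < length xs then xs ! i else 0"
  have "distinct xs" if indep: "alg_indep_fam (length xs) ?f"
    unfolding distinct_conv_nth
  proof (intro allI impI notI)
    fix i j assume ij: "i < length xs" "j < length xs" "i \<noteq> j" "xs ! i = xs ! j"
    have "ffeval ?f (mvar i - mvar j) = 0"
      using ij by (simp add: ff.minsert_diff ff.minsert_mvar)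
    moreover have "mvars (mvar i - mvar j :: 'a mpoly) \<subseteq> {..<length xs}"
      using ij mvars_diff[of "mvar i :: 'a mpoly" "mvar j"] by auto
    ultimately have "mvar i - mvar j = (0 :: 'a mpoly)"
      using indep unfolding alg_indep_fam_def by blast
    then have "mpderiv i (mvar i :: 'a mpoly) = mpderiv i (mvar j)"
      by simp
    then show False using ij by (simp add: mpderiv_mvar)
  qed
  then have "alg_indep xs \<longleftrightarrow> alg_indep_fam (length xs) ?f"
    unfolding alg_indep_def alg_indep_fam_def by blast
  also have "\<dots> \<longleftrightarrow> alg_indep_fam (length xs) (\<lambda>i. xs ! i)"
    by (rule alg_indep_fam_cong) simp
  finally show ?thesis .
qed

lemma ffderiv_ffeval:
  assumes "mvars P \<subseteq> {..<s}"
  shows "ffderiv l (ffeval f P) = (\<Sum>j<s. ffeval f (mpderiv j P) * ffderiv l (f j))"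
proof -
  \<comment> \<open>The chain rule asks for derivative 0 outside a finite set of arguments, so the
    family is cut off at \<open>s\<close>; \<open>P\<close> does not see the change.\<close>
  let ?g = "\<lambda>i. if i < s then f i else 0"
  have cong: "ffeval f Q = ffeval ?g Q" if "mvars Q \<subseteq> {..<s}" for Q
    by (rule minsert_cong) (use that in auto)
  have "ffderiv l (ffeval ?g P) = (\<Sum>j<s. ffeval ?g (mpderiv j P) * ffderiv l (?g j))"
    by (intro ff.deriv_minsert) auto
  also have "\<dots> = (\<Sum>j<s. ffeval f (mpderiv j P) * ffderiv l (f j))"
    using cong[OF order.trans[OF mvars_mpderiv assms]] by (intro sum.cong) simp_all
  finally show ?thesis
    unfolding cong[OF assms] .
qed

text \<open>Differentiating a relation \<open>P\<close> among the \<open>f i\<close> gives a linear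
  relation among the rows of the Jacobian, whose coefficients are the values of the partial
  derivatives of \<open>P\<close>. These vanish, so the derivatives are relations of smaller degree,
  hence zero by induction, and \<open>P\<close> is constant.\<close>

lemma lin_indep_jacobian_imp_alg_indep:
  fixes f :: "nat \<Rightarrow> 'a::field_char_0 mpoly fract"
  assumes indep: "lin_indep {..<s} L (\<lambda>i l. ffderiv l (f i))"
  shows "alg_indep_fam s f"
proof -
  have "P = 0" if "deg_le d P" "mvars P \<subseteq> {..<s}" "ffeval f P = 0" for d P
    using that
  proof (induction d arbitrary: P)
    case 0
    then have "P = mconst (Poly_Mapping.lookup P 0)"
      by (intro mvars_empty_imp_const deg_le_0_imp_const)
    then show ?case using "0.prems"(3)
      by (metis ff.minsert_mconst to_ff_eq_0_iff)
  next
    case (Suc d)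
    have "(\<Sum>j<s. ffeval f (mpderiv j P) * ffderiv l (f j)) = 0" for l
      using ffderiv_ffeval[OF Suc.prems(2), of l f] Suc.prems(3) by simp
    then have "ffeval f (mpderiv j P) = 0" if "j < s" for j
      using lin_indepD[OF indep, of "\<lambda>j. ffeval f (mpderiv j P)"] that by simp
    then have "mpderiv j P = 0" if "j < s" for j
      using that Suc.prems by (intro Suc.IH deg_le_mpderiv order.trans[OF mvars_mpderiv]) auto
    then have "mvars P = {}"
      using Suc.prems(2) by (auto dest!: mpderiv_eq_0_imp_not_mvars)
    then have "P = mconst (Poly_Mapping.lookup P 0)"
      by (rule mvars_empty_imp_const)
    then show ?case using Suc.prems(3)
      by (metis ff.minsert_mconst to_ff_eq_0_iff)
  qed
  then show ?thesis unfolding alg_indep_fam_def using ex_deg_le by blast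
qed

subsection \<open>An upper bound on the number of independent rational functions\<close>

text \<open>There are infinitely many variables, so independent families in the whole function field
  can have any size; a finite \<open>V\<close> restores a bound.\<close>

definition rational_in :: "nat set \<Rightarrow> 'a::field mpoly fract set" where
  "rational_in V = {to_ff p / to_ff q | p q. mvars p \<subseteq> V \<and> mvars q \<subseteq> V \<and> q \<noteq> 0}"

lemma common_denominator:
  assumes "finite I" "\<And>i. i \<in> I \<Longrightarrow> x i \<in> rational_in V"
  obtains q P where "q \<noteq> 0" "mvars q \<subseteq> V"
    "\<And>i. i \<in> I \<Longrightarrow> mvars (P i) \<subseteq> V" "\<And>i. i \<in> I \<Longrightarrow> x i = to_ff (P i) / to_ff q"
proof -
  have "\<forall>i\<in>I. \<exists>p q. x i = to_ff p / to_ff q \<and> mvars p \<subseteq> V \<and> mvars q \<subseteq> V \<and> q \<noteq> 0"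
    using assms(2) unfolding rational_in_def by blast
  then obtain p q where pq: "\<And>i. i \<in> I \<Longrightarrow>
      x i = to_ff (p i) / to_ff (q i) \<and> mvars (p i) \<subseteq> V \<and> mvars (q i) \<subseteq> V \<and> q i \<noteq> 0"
    by metis
  let ?Q = "\<Prod>i\<in>I. q i" and ?P = "\<lambda>i. p i * (\<Prod>j\<in>I - {i}. q j)"
  show thesis
  proof (rule that[of ?Q ?P])
    show "?Q \<noteq> 0" using pq assms(1) by simp
    show "mvars ?Q \<subseteq> V" using pq by (intro mvars_prod) auto
    fix i assume i: "i \<in> I"
    have "mvars (\<Prod>j\<in>I - {i}. q j) \<subseteq> V" using pq by (intro mvars_prod) auto
    then show "mvars (?P i) \<subseteq> V" using pq[OF i] mvars_mult[of "p i"] by blast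
    have "?Q = q i * (\<Prod>j\<in>I - {i}. q j)" using assms(1) i by (rule prod.remove)
    moreover have "(\<Prod>j\<in>I - {i}. q j) \<noteq> 0" using pq assms(1) by simp
    ultimately show "x i = to_ff (?P i) / to_ff ?Q" using pq[OF i] by simp
  qed
qed

section \<open>Monomials with bounded exponents\<close>

definition exp_box :: "nat \<Rightarrow> nat \<Rightarrow> (nat \<Rightarrow>\<^sub>0 nat) set" where
  "exp_box t d = {m. Poly_Mapping.keys m \<subseteq> {..<t} \<and> (\<forall>k. Poly_Mapping.lookup m k < d)}"

lemma exp_box_card:
  assumes "0 < d"
  shows "finite (exp_box t d)" "card (exp_box t d) = d ^ t"
proof -
  define to_pm where "to_pm = (\<lambda>g k. if k < t then g k else (0::nat))"
  have fin: "finite {k. to_pm g k \<noteq> 0}" for g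
    by (rule finite_subset[of _ "{..<t}"]) (auto simp: to_pm_def)
  have "bij_betw (\<lambda>m. restrict (Poly_Mapping.lookup m) {..<t}) (exp_box t d) ({..<t} \<rightarrow>\<^sub>E {..<d})"
  proof (rule bij_betw_byWitness[where f' = "\<lambda>g. Abs_poly_mapping (to_pm g)"])
    show "\<forall>m\<in>exp_box t d. Abs_poly_mapping (to_pm (restrict (Poly_Mapping.lookup m) {..<t})) = m"
      using fin by (auto simp: exp_box_def in_keys_iff to_pm_def intro!: poly_mapping_eqI)
    show "\<forall>g\<in>{..<t} \<rightarrow>\<^sub>E {..<d}. restrict (Poly_Mapping.lookup (Abs_poly_mapping (to_pm g))) {..<t} = g"
      using fin by (auto simp: to_pm_def restrict_def PiE_def extensional_def)
    show "(\<lambda>m. restrict (Poly_Mapping.lookup m) {..<t}) ` exp_box t d \<subseteq> {..<t} \<rightarrow>\<^sub>E {..<d}"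
      by (auto simp: exp_box_def PiE_def extensional_def)
    show "(\<lambda>g. Abs_poly_mapping (to_pm g)) ` ({..<t} \<rightarrow>\<^sub>E {..<d}) \<subseteq> exp_box t d"
      using fin assms by (auto simp: exp_box_def in_keys_iff to_pm_def split: if_splits)
  qed
  then show "finite (exp_box t d)" "card (exp_box t d) = d ^ t"
    by (simp_all add: bij_betw_finite finite_PiE bij_betw_same_card card_PiE)
qed

text \<open>Bounding each exponent separately, not the total degree, makes the admissible monomials
  fill a box, whose cardinality is an exact power.\<close>

definition exp_le :: "nat \<Rightarrow> 'a::zero mpoly \<Rightarrow> bool" where
  "exp_le E p \<longleftrightarrow> (\<forall>m\<in>Poly_Mapping.keys p. \<forall>k. Poly_Mapping.lookup m k \<le> E)"

lemma ex_exp_le: "\<exists>E. exp_le E p"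
proof -
  obtain d where d: "deg_le d p" using ex_deg_le by blast
  have "Poly_Mapping.lookup m k \<le> d" if m: "m \<in> Poly_Mapping.keys p" for m k
  proof (cases "k \<in> Poly_Mapping.keys m")
    case True
    then have "Poly_Mapping.lookup m k \<le> (\<Sum>i\<in>Poly_Mapping.keys m. Poly_Mapping.lookup m i)"
      by (intro member_le_sum) auto
    then show ?thesis using d m by (auto simp: deg_le_def)
  qed (simp add: in_keys_iff)
  then show ?thesis by (auto simp: exp_le_def)
qed

lemma exp_le_mono: "exp_le E p \<Longrightarrow> E \<le> F \<Longrightarrow> exp_le F p"
  unfolding exp_le_def by (meson order.trans)

lemma exp_le_one: "exp_le E (1 :: 'a::comm_ring_1 mpoly)"
  by (simp add: exp_le_def)

lemma exp_le_mult:
  assumes "exp_le E p" "exp_le F q"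
  shows "exp_le (E + F) (p * q)"
  unfolding exp_le_def
proof (intro ballI allI)
  fix m k assume "m \<in> Poly_Mapping.keys (p * q)"
  then obtain a b where "m = a + b" "a \<in> Poly_Mapping.keys p" "b \<in> Poly_Mapping.keys q"
    using keys_mult[of p q] by auto
  then show "Poly_Mapping.lookup m k \<le> E + F"
    using assms by (auto simp: exp_le_def lookup_add intro!: add_mono)
qed

lemma exp_le_power:
  fixes p :: "'a::comm_ring_1 mpoly"
  assumes "exp_le E p"
  shows "exp_le (k * E) (p ^ k)"
  by (induction k) (auto intro: exp_le_one exp_le_mult assms)

lemma exp_le_prod:
  fixes p :: "'i \<Rightarrow> 'a::comm_ring_1 mpoly"
  assumes "\<And>i. i \<in> A \<Longrightarrow> exp_le E (p i)"
  shows "exp_le (card A * E) (\<Prod>i\<in>A. p i)"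
  using assms
  by (induction A rule: infinite_finite_induct) (auto intro: exp_le_one exp_le_mult)

lemma lookup_mconst_mult: "Poly_Mapping.lookup (mconst c * p) m = c * Poly_Mapping.lookup p m"
proof (induction p rule: poly_mapping_add_induct)
  case (single k b)
  show ?case by (simp add: mconst_def mult_single lookup_single when_def)
qed (simp add: distrib_left lookup_add)

text \<open>The monomials with exponents below \<open>d\<close> in \<open>t\<close> fractions with common denominator \<open>q\<close>,
  multiplied by \<open>q ^ (d * t)\<close>, are polynomials in \<open>M\<close> variables with exponents \<open>O(d)\<close>. For \<open>M < t\<close> and large \<open>d\<close>
  there are more such monomials, \<open>d ^ t\<close>, than the dimension \<open>O(d ^ M)\<close> of the space containing them.\<close>

lemma alg_indep_fam_le:
  fixes f :: "nat \<Rightarrow> 'a::field mpoly fract"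
  assumes indep: "alg_indep_fam t f" and f: "\<And>i. i < t \<Longrightarrow> f i \<in> rational_in {..<M}"
  shows "t \<le> M"
proof (rule ccontr)
  assume "\<not> t \<le> M"
  then have tM: "Suc M \<le> t" by simp
  obtain q P where q: "q \<noteq> 0" "mvars q \<subseteq> {..<M}"
    and P: "\<And>i. i \<in> {..<t} \<Longrightarrow> mvars (P i) \<subseteq> {..<M}"
    and fP: "\<And>i. i \<in> {..<t} \<Longrightarrow> f i = to_ff (P i) / to_ff q"
    by (rule common_denominator[of "{..<t}" f "{..<M}"]) (use f in auto)
  have "\<forall>i. \<exists>e. exp_le e (P i)" by (simp add: ex_exp_le)
  then obtain e where e: "\<And>i. exp_le (e i) (P i)" by metis
  obtain eq where eq: "exp_le eq q" using ex_exp_le by metis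
  define E where "E = eq + (\<Sum>i<t. e i)"
  have EP: "exp_le E (P i)" if "i < t" for i
  proof -
    have "e i \<le> (\<Sum>i<t. e i)" using that by (intro member_le_sum) auto
    then show ?thesis using exp_le_mono[OF e, of i E] by (simp add: E_def)
  qed
  have Eq: "exp_le E q" using exp_le_mono[OF eq, of E] by (simp add: E_def)
  \<comment> \<open>Since \<open>card ?J \<le> (t * E + 1) ^ M * d ^ M\<close> and
    \<open>M < t\<close>, any \<open>d\<close> above \<open>(t * E + 1) ^ M\<close> gives
    \<open>card ?J < d ^ (M + 1) \<le> d ^ t = card ?I\<close>.\<close>
  define d where "d = (t * E + 1) ^ M + 1"
  \<comment> \<open>The factor for \<open>i\<close> is padded so that it absorbs exactly
    \<open>d\<close> denominators \<open>q\<close>, whatever the exponent of \<open>i\<close> in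
    \<open>\<alpha>\<close>.\<close>
  define Q where "Q = (\<lambda>\<alpha>. \<Prod>i<t. P i ^ Poly_Mapping.lookup \<alpha> i * q ^ (d - Poly_Mapping.lookup \<alpha> i))"
  let ?I = "exp_box t d" and ?J = "exp_box M (t * (d * E) + 1)"
  have d: "0 < d" by (simp add: d_def)
  have keysQ: "Poly_Mapping.keys (Q \<alpha>) \<subseteq> ?J" if \<alpha>: "\<alpha> \<in> ?I" for \<alpha>
  proof -
    have "exp_le (d * E) (P i ^ Poly_Mapping.lookup \<alpha> i * q ^ (d - Poly_Mapping.lookup \<alpha> i))" if "i < t" for i
    proof -
      have "Poly_Mapping.lookup \<alpha> i < d" using \<alpha> by (simp add: exp_box_def)
      then have "Poly_Mapping.lookup \<alpha> i * E + (d - Poly_Mapping.lookup \<alpha> i) * E = d * E"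
        by (simp add: add_mult_distrib[symmetric])
      then show ?thesis
        using exp_le_mult[OF exp_le_power[OF EP[OF that]] exp_le_power[OF Eq]] by metis
    qed
    then have "exp_le (t * (d * E)) (Q \<alpha>)"
      using exp_le_prod[of "{..<t}" "d * E"
          "\<lambda>i. P i ^ Poly_Mapping.lookup \<alpha> i * q ^ (d - Poly_Mapping.lookup \<alpha> i)"]
      by (simp add: Q_def)
    moreover have "mvars (Q \<alpha>) \<subseteq> {..<M}"
      unfolding Q_def using P q by (intro mvars_prod order.trans[OF mvars_mult] Un_least mvars_power) auto
    ultimately show ?thesis
      by (fastforce simp: exp_le_def exp_box_def mvars_def less_Suc_eq_le)
  qed
  have "card ?J = (t * (d * E) + 1) ^ M" by (intro exp_box_card) simp
  also have "\<dots> \<le> ((t * E + 1) * d) ^ M"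
    using d by (intro power_mono) (simp_all add: algebra_simps)
  also have "\<dots> = (t * E + 1) ^ M * d ^ M" by (rule power_mult_distrib)
  also have "\<dots> < d * d ^ M" using d by (intro mult_strict_right_mono) (simp_all add: d_def)
  also have "\<dots> \<le> d ^ t" using power_increasing[OF tM, of d] d by simp
  also have "\<dots> = card ?I" using exp_box_card(2)[OF d, of t] by simp
  \<comment> \<open>One equation for each monomial that can occur and one unknown for each
    \<open>\<alpha>\<close>: a solution is a linear relation among the
    \<open>Q \<alpha>\<close>.\<close>
  finally obtain a where a: "\<exists>\<alpha>\<in>?I. a \<alpha> \<noteq> 0"
    "\<And>\<beta>. \<beta> \<in> ?J \<Longrightarrow> (\<Sum>\<alpha>\<in>?I. a \<alpha> * Poly_Mapping.lookup (Q \<alpha>) \<beta>) = 0"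
    using homogeneous_system_solution[of ?J ?I "\<lambda>\<alpha>. Poly_Mapping.lookup (Q \<alpha>)"]
      exp_box_card(1)[OF d, of t] exp_box_card(1)[of "t * (d * E) + 1" M] by auto
  have rel: "(\<Sum>\<alpha>\<in>?I. mconst (a \<alpha>) * Q \<alpha>) = 0"
  proof (rule poly_mapping_eqI)
    fix \<beta>
    have "Poly_Mapping.lookup (Q \<alpha>) \<beta> = 0" if "\<beta> \<notin> ?J" "\<alpha> \<in> ?I" for \<alpha>
      using that keysQ[OF that(2)] by (meson in_keys_iff subsetD)
    then have "(\<Sum>\<alpha>\<in>?I. a \<alpha> * Poly_Mapping.lookup (Q \<alpha>) \<beta>) = 0"
      using a(2) by (cases "\<beta> \<in> ?J") auto
    then show "Poly_Mapping.lookup (\<Sum>\<alpha>\<in>?I. mconst (a \<alpha>) * Q \<alpha>) \<beta> = Poly_Mapping.lookup 0 \<beta>"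
      by (simp add: lookup_sum lookup_mconst_mult)
  qed
  define R where "R = (\<Sum>\<alpha>\<in>?I. Poly_Mapping.single \<alpha> (a \<alpha>))"
  have "Poly_Mapping.lookup R \<alpha> = a \<alpha>" if "\<alpha> \<in> ?I" for \<alpha>
    using that exp_box_card(1)[OF d, of t]
    by (simp add: R_def lookup_sum lookup_single when_def sum.delta)
  then have "R \<noteq> 0" using a(1) by force
  moreover have "mvars R \<subseteq> {..<t}"
    unfolding R_def by (intro mvars_sum) (auto simp: mvars_def exp_box_def)
  moreover have "ffeval f R = 0"
  proof -
    have mono: "(\<Prod>i\<in>Poly_Mapping.keys \<alpha>. f i ^ Poly_Mapping.lookup \<alpha> i) = to_ff (Q \<alpha>) / to_ff q ^ (d * t)"
      if \<alpha>: "\<alpha> \<in> ?I" for \<alpha>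
    proof -
      have "(\<Prod>i\<in>Poly_Mapping.keys \<alpha>. f i ^ Poly_Mapping.lookup \<alpha> i) = (\<Prod>i<t. f i ^ Poly_Mapping.lookup \<alpha> i)"
        using \<alpha> by (intro prod.mono_neutral_left) (auto simp: exp_box_def in_keys_iff)
      also have "\<dots> = (\<Prod>i<t. to_ff (P i ^ Poly_Mapping.lookup \<alpha> i * q ^ (d - Poly_Mapping.lookup \<alpha> i)) / to_ff q ^ d)"
      proof (intro prod.cong refl)
        fix i assume i: "i \<in> {..<t}"
        have "Poly_Mapping.lookup \<alpha> i < d" using \<alpha> by (simp add: exp_box_def)
        then have "to_ff q ^ d = to_ff q ^ Poly_Mapping.lookup \<alpha> i * to_ff q ^ (d - Poly_Mapping.lookup \<alpha> i)"
          by (simp add: power_add[symmetric])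
        then show "f i ^ Poly_Mapping.lookup \<alpha> i =
            to_ff (P i ^ Poly_Mapping.lookup \<alpha> i * q ^ (d - Poly_Mapping.lookup \<alpha> i)) / to_ff q ^ d"
          using q(1) fP[OF i] by (simp add: to_ff_power power_divide)
      qed
      also have "\<dots> = to_ff (Q \<alpha>) / to_ff q ^ (d * t)"
        by (simp add: prod_dividef Q_def to_ff_prod power_mult)
      finally show ?thesis .
    qed
    have "ffeval f R = (\<Sum>\<alpha>\<in>?I. to_ff (mconst (a \<alpha>) * Q \<alpha>) / to_ff q ^ (d * t))"
      by (simp add: R_def ff.minsert_sum ff.minsert_single mono)
    also have "\<dots> = to_ff (\<Sum>\<alpha>\<in>?I. mconst (a \<alpha>) * Q \<alpha>) / to_ff q ^ (d * t)"
      by (simp add: to_ff_sum sum_divide_distrib)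
    finally show ?thesis by (simp add: rel)
  qed
  ultimately show False using indep unfolding alg_indep_fam_def by blast
qed

subsection \<open>Algebraically independent functions have independent differentials\<close>

text \<open>Implicit differentiation of a relation of least degree between \<open>g\<close> and
  \<open>x\<close>: by minimality its partial derivative in the slot of \<open>x\<close> is nonzero
  at \<open>(g, x)\<close> and can be divided by. The coefficients obtained are the same for all
  directions \<open>l\<close>.\<close>

lemma ffderiv_algebraic:
  fixes g :: "nat \<Rightarrow> 'a::field_char_0 mpoly fract"
  assumes indep: "alg_indep_fam t g" and dep: "\<not> alg_indep_fam (Suc t) (g(t := x))"
  shows "\<exists>A. \<forall>l. ffderiv l x = (\<Sum>j<t. A j * ffderiv l (g j))"
proof -
  let ?g = "g(t := x)"
  define rel where "rel = (\<lambda>d P. deg_le d P \<and> P \<noteq> 0 \<and> mvars P \<subseteq> {..<Suc t} \<and> ffeval ?g P = 0)"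
  have "\<exists>d P. rel d P"
    using dep ex_deg_le unfolding rel_def alg_indep_fam_def by blast
  then obtain d P where P: "rel d P" and min: "\<And>d' P'. d' < d \<Longrightarrow> \<not> rel d' P'"
    using exists_least_iff[of "\<lambda>d. \<exists>P. rel d P"] by blast
  have "d \<noteq> 0"
  proof
    assume "d = 0"
    then have "P = mconst (Poly_Mapping.lookup P 0)"
      using P by (intro mvars_empty_imp_const deg_le_0_imp_const) (simp add: rel_def)
    then show False
      using P unfolding rel_def by (metis ff.minsert_mconst to_ff_eq_0_iff)
  qed
  then obtain d' where d': "d = Suc d'" by (cases d) auto
  \<comment> \<open>Otherwise the last variable would not occur in \<open>P\<close>, which would
    then be a nontrivial relation among the \<open>g j\<close> alone.\<close>
  have "mpderiv t P \<noteq> 0"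
  proof
    assume "mpderiv t P = 0"
    then have "t \<notin> mvars P" by (rule mpderiv_eq_0_imp_not_mvars)
    then have "mvars P \<subseteq> {..<t}" using P by (fastforce simp: rel_def less_Suc_eq)
    moreover from this have "ffeval g P = ffeval ?g P" by (intro minsert_cong) auto
    ultimately show False
      using P indep unfolding rel_def alg_indep_fam_def by auto
  qed
  moreover have "deg_le d' (mpderiv t P)" "mvars (mpderiv t P) \<subseteq> {..<Suc t}"
    using P d' mvars_mpderiv[of t P] by (auto simp: rel_def intro: deg_le_mpderiv)
  ultimately have nz: "ffeval ?g (mpderiv t P) \<noteq> 0"
    using min[of d' "mpderiv t P"] d' by (auto simp: rel_def)
  have "ffderiv l x = (\<Sum>j<t. - ffeval ?g (mpderiv j P) / ffeval ?g (mpderiv t P) * ffderiv l (g j))" for l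
  proof -
    have "0 = ffderiv l (ffeval ?g P)" using P by (simp add: rel_def)
    also have "\<dots> = (\<Sum>j<Suc t. ffeval ?g (mpderiv j P) * ffderiv l (?g j))"
      using P by (intro ffderiv_ffeval) (simp add: rel_def)
    also have "\<dots> = (\<Sum>j<t. ffeval ?g (mpderiv j P) * ffderiv l (g j)) + ffeval ?g (mpderiv t P) * ffderiv l x"
      by simp
    finally have "ffderiv l x = - (\<Sum>j<t. ffeval ?g (mpderiv j P) * ffderiv l (g j)) / ffeval ?g (mpderiv t P)"
      using nz by (simp add: field_simps eq_neg_iff_add_eq_0 add.commute)
    then show ?thesis
      by (simp add: sum_divide_distrib sum_negf)
  qed
  then show ?thesis by (intro exI allI)
qed

text \<open>Extend the family to a maximal independent one \<open>g\<close>, of size \<open>t \<le> M\<close>. The coordinates are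
  algebraic over it, so their differentials, the \<open>M\<close> unit vectors, are combinations of the \<open>t\<close> differentials of
  \<open>g\<close>, which are therefore independent.\<close>

lemma alg_indep_imp_lin_indep_jacobian:
  fixes f :: "nat \<Rightarrow> 'a::field_char_0 mpoly fract"
  assumes indep: "alg_indep_fam s f" and f: "\<And>i. i < s \<Longrightarrow> f i \<in> rational_in {..<M}"
  shows "lin_indep {..<s} {..<M} (\<lambda>i l. ffderiv l (f i))"
proof -
  define ext where "ext = (\<lambda>t g. alg_indep_fam t g \<and> s \<le> t \<and> (\<forall>i<s. g i = f i) \<and>
    (\<forall>i<t. g i \<in> rational_in {..<M}))"
  have le: "t \<le> M" if "\<exists>g. ext t g" for t
    using that alg_indep_fam_le unfolding ext_def by blast
  have "\<exists>g. ext s g" using indep f unfolding ext_def by blast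
  then have "\<exists>t. (\<exists>g. ext t g) \<and> (\<forall>t'. (\<exists>g. ext t' g) \<longrightarrow> t' \<le> t)"
    by (rule ex_has_greatest_nat[where f = "\<lambda>t. t" and b = "Suc M"]) (use le in \<open>simp add: less_Suc_eq_le\<close>)
  then obtain t g where g: "ext t g" and max: "\<And>t' g'. ext t' g' \<Longrightarrow> t' \<le> t"
    by blast
  have "\<exists>A. \<forall>l. ffderiv l (to_ff (mvar i)) = (\<Sum>j<t. A j * ffderiv l (g j))" if i: "i < M" for i
  proof (rule ffderiv_algebraic)
    show "alg_indep_fam t g" using g by (simp add: ext_def)
    have "to_ff (mvar i) / to_ff 1 \<in> rational_in {..<M}"
      unfolding rational_in_def using i by fastforce
    then have "to_ff (mvar i) \<in> rational_in {..<M}" by simp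
    then show "\<not> alg_indep_fam (Suc t) (g(t := to_ff (mvar i)))"
      using g max[of "Suc t" "g(t := to_ff (mvar i))"] by (auto simp: ext_def less_Suc_eq)
  qed
  then obtain A where A: "\<And>i l. i < M \<Longrightarrow>
      ffderiv l (to_ff (mvar i)) = (\<Sum>j<t. A i j * ffderiv l (g j))"
    by metis
  show ?thesis unfolding lin_indep_def
  proof (intro allI impI ballI)
    fix b k
    assume b: "\<forall>l\<in>{..<M}. (\<Sum>i<s. b i * ffderiv l (f i)) = 0" and k: "k \<in> {..<s}"
    define b' where "b' = (\<lambda>j. if j < s then b j else 0)"
    have b': "(\<Sum>j<t. b' j * ffderiv l (g j)) = 0" if "l < M" for l
    proof -
      have "(\<Sum>j<t. b' j * ffderiv l (g j)) = (\<Sum>j<s. b' j * ffderiv l (g j))"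
        using g by (intro sum.mono_neutral_right) (auto simp: ext_def b'_def)
      also have "\<dots> = (\<Sum>j<s. b j * ffderiv l (f j))"
        using g by (intro sum.cong) (auto simp: ext_def b'_def)
      finally show ?thesis using b that by simp
    qed
    \<comment> \<open>There are \<open>M + 1\<close> vectors of length \<open>t \<le> M\<close>: the
      \<open>M\<close> rows of \<open>A\<close> and, at index \<open>M\<close>, the zero-padded
      coefficients \<open>b'\<close>. Hence they are dependent.\<close>
    have "t < Suc M" using le g by (auto simp: less_Suc_eq_le)
    then obtain a where a: "\<exists>i<Suc M. a i \<noteq> 0"
      "\<And>j. j < t \<Longrightarrow> (\<Sum>i<Suc M. a i * (if i < M then A i j else b' j)) = 0"
      using homogeneous_system_solution[of "{..<t}" "{..<Suc M}" "\<lambda>i j. if i < M then A i j else b' j"]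
      by auto
    have sys: "(\<Sum>i<M. a i * A i j) + a M * b' j = 0" if "j < t" for j
      using a(2)[OF that] by simp
    \<comment> \<open>Pairing the dependency with the differentials of \<open>g\<close> turns row
      \<open>i\<close> of \<open>A\<close> into the \<open>i\<close>-th unit vector and
      \<open>b'\<close> into 0, which isolates \<open>a l\<close>. Only \<open>a M\<close> can then
      be nonzero, and this forces \<open>b'\<close> to vanish.\<close>
    have "a l = 0" if l: "l < M" for l
    proof -
      have "0 = (\<Sum>j<t. ((\<Sum>i<M. a i * A i j) + a M * b' j) * ffderiv l (g j))"
        by (simp add: sys)
      also have "\<dots> = (\<Sum>j<t. \<Sum>i<M. a i * (A i j * ffderiv l (g j))) + a M * (\<Sum>j<t. b' j * ffderiv l (g j))"
        by (simp add: distrib_right sum.distrib sum_distrib_left sum_distrib_right mult.assoc)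
      also have "(\<Sum>j<t. \<Sum>i<M. a i * (A i j * ffderiv l (g j))) =
          (\<Sum>i<M. a i * (\<Sum>j<t. A i j * ffderiv l (g j)))"
        by (subst sum.swap) (simp add: sum_distrib_left)
      also have "\<dots> = (\<Sum>i<M. a i * ffderiv l (to_ff (mvar i)))"
        by (simp add: A del: ffderiv_to_ff)
      also have "\<dots> = (\<Sum>i<M. if i = l then a i else 0)"
        by (intro sum.cong) (auto simp: mpderiv_mvar)
      also have "\<dots> = a l" using l by simp
      finally show ?thesis using b'[OF l] by simp
    qed
    then have "a M \<noteq> 0" using a(1) by (auto simp: less_Suc_eq)
    moreover have "(\<Sum>i<M. a i * A i k) = 0" using \<open>\<And>l. l < M \<Longrightarrow> a l = 0\<close> by simp
    ultimately have "b' k = 0" using sys[of k] k g by (auto simp: ext_def)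
    then show "b k = 0" using k by (simp add: b'_def)
  qed
qed

section \<open>Transcendence degree as the rank of the Jacobian\<close>

lemma gen_field_rational:
  assumes x: "x \<in> gen_field m g" and g: "\<And>i. i < m \<Longrightarrow> mvars (g i) \<subseteq> V"
  shows "x \<in> rational_in V" and "\<exists>B. \<forall>l. ffderiv l x = (\<Sum>j<m. B j * to_ff (mpderiv l (g j)))"
proof -
  define gf where "gf = (\<lambda>i. if i < m then to_ff (g i) else 0)"
  define g0 where "g0 = (\<lambda>i. if i < m then g i else 0)"
  have "coeff_hom (to_ff :: 'a mpoly \<Rightarrow> _)" by unfold_locales simp_all
  moreover have "gf = (\<lambda>i. to_ff (g0 i))" by (auto simp: gf_def g0_def)
  ultimately have ev: "ffeval gf p = to_ff (minsert mconst g0 p)" for p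
    using minsert_hom_comp[OF coeff_hom_mconst, of to_ff g0 p] by simp
  obtain p q where x: "x = ffeval gf p / ffeval gf q" and q: "ffeval gf q \<noteq> 0"
    using x unfolding gen_field_def gf_def by (auto simp: Let_def)
  have "mvars (minsert mconst g0 r) \<subseteq> V" for r
    using g by (intro mvars_minsert) (auto simp: g0_def)
  then show "x \<in> rational_in V"
    using q unfolding x ev rational_in_def by auto
  \<comment> \<open>The partial derivative of \<open>p / q\<close> in the \<open>j\<close>-th
    generator, by the quotient rule.\<close>
  define B where "B = (\<lambda>j. ffeval gf (mpderiv j p) / ffeval gf q
      - ffeval gf p / (ffeval gf q * ffeval gf q) * ffeval gf (mpderiv j q))"
  have "ffderiv l x = (\<Sum>j<m. B j * to_ff (mpderiv l (g j)))" for l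
  proof -
    have "ffderiv l (ffeval gf r) = (\<Sum>j<m. ffeval gf (mpderiv j r) * to_ff (mpderiv l (g j)))" for r
      using ff.deriv_minsert[of "{..<m}" l gf r] by (simp add: gf_def)
    then show ?thesis
      using q unfolding x ffderiv_divide[OF q]
      by (simp add: B_def left_diff_distrib sum_subtractf sum_divide_distrib sum_distrib_left mult.assoc)
  qed
  then show "\<exists>B. \<forall>l. ffderiv l x = (\<Sum>j<m. B j * to_ff (mpderiv l (g j)))" by blast
qed

lemma to_ff_in_gen_field:
  assumes "i < m"
  shows "to_ff (g i) \<in> gen_field m g"
proof -
  let ?gf = "\<lambda>i. if i < m then to_ff (g i) else 0"
  have "to_ff (g i) = ffeval ?gf (mvar i) / ffeval ?gf 1" "ffeval ?gf 1 \<noteq> 0"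
    using assms by (simp_all add: ff.minsert_mvar)
  then show ?thesis unfolding gen_field_def Let_def by blast
qed

text \<open>Independent elements of the generated field have independent differentials, all in the
  span of the \<open>u j\<close>, so there are at most \<open>card S\<close> of them; the
  \<open>g j\<close> with \<open>j \<in> S\<close> attain this number. The upper bound uses only how
  many \<open>u j\<close> there are, so they need not be differentials of the
  \<open>g j\<close>.\<close>

lemma trdeg_eq_rank:
  fixes g :: "nat \<Rightarrow> 'a::field_char_0 mpoly"
  assumes g: "\<And>i. i < m \<Longrightarrow> mvars (g i) \<subseteq> {..<M}"
    and S: "S \<subseteq> {..<m}"
    and span: "\<And>i. i < m \<Longrightarrow> \<exists>b. \<forall>l<M. to_ff (mpderiv l (g i)) = (\<Sum>j\<in>S. b j * u j l)"
    and indep: "lin_indep S {..<M} (\<lambda>i l. to_ff (mpderiv l (g i)))"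
  shows "trdeg m g = enat (card S)"
  unfolding trdeg_def
proof (rule antisym)
  have finS: "finite S" using S finite_subset by blast
  obtain b where b: "\<And>i l. i < m \<Longrightarrow> l < M \<Longrightarrow> to_ff (mpderiv l (g i)) = (\<Sum>j\<in>S. b i j * u j l)"
    using span by metis
  show "(SUP xs\<in>{xs. set xs \<subseteq> gen_field m g \<and> alg_indep xs}. enat (length xs)) \<le> enat (card S)"
  proof (rule SUP_least)
    fix xs assume "xs \<in> {xs. set xs \<subseteq> gen_field m g \<and> alg_indep xs}"
    then have xs: "\<And>i. i < length xs \<Longrightarrow> xs ! i \<in> gen_field m g"
      and ind: "alg_indep_fam (length xs) (\<lambda>i. xs ! i)"
      by (auto simp: alg_indep_iff)
    have "\<forall>i\<in>{..<length xs}. \<exists>B. \<forall>l. ffderiv l (xs ! i) = (\<Sum>k<m. B k * to_ff (mpderiv l (g k)))"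
      using gen_field_rational(2)[OF xs g] by blast
    then obtain B where "\<forall>i\<in>{..<length xs}. \<forall>l.
        ffderiv l (xs ! i) = (\<Sum>k<m. B i k * to_ff (mpderiv l (g k)))"
      unfolding bchoice_iff by blast
    then have B: "\<And>i l. i < length xs \<Longrightarrow>
        ffderiv l (xs ! i) = (\<Sum>k<m. B i k * to_ff (mpderiv l (g k)))"
      by simp
    have lin: "lin_indep {..<length xs} {..<M} (\<lambda>i l. ffderiv l (xs ! i))"
      using ind gen_field_rational(1)[OF xs g] by (rule alg_indep_imp_lin_indep_jacobian)
    define c where "c = (\<lambda>i j. \<Sum>k<m. B i k * b k j)"
    have c: "ffderiv l (xs ! i) = (\<Sum>j\<in>S. c i j * u j l)" if "i < length xs" "l < M" for i l
    proof -
      have "ffderiv l (xs ! i) = (\<Sum>k<m. \<Sum>j\<in>S. B i k * b k j * u j l)"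
        using that by (simp add: B b sum_distrib_left mult.assoc)
      also have "\<dots> = (\<Sum>j\<in>S. c i j * u j l)"
        by (subst sum.swap) (simp add: c_def sum_distrib_right)
      finally show ?thesis .
    qed
    show "enat (length xs) \<le> enat (card S)"
    proof (rule ccontr)
      assume "\<not> enat (length xs) \<le> enat (card S)"
      then obtain a where a: "\<exists>i\<in>{..<length xs}. a i \<noteq> 0"
        "\<And>j. j \<in> S \<Longrightarrow> (\<Sum>i<length xs. a i * c i j) = 0"
        using homogeneous_system_solution[of S "{..<length xs}" c] finS by auto
      have "(\<Sum>i<length xs. a i * ffderiv l (xs ! i)) = 0" if "l < M" for l
      proof -
        have "(\<Sum>i<length xs. a i * ffderiv l (xs ! i)) = (\<Sum>i<length xs. \<Sum>j\<in>S. a i * c i j * u j l)"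
          using that by (simp add: c sum_distrib_left mult.assoc)
        also have "\<dots> = (\<Sum>j\<in>S. (\<Sum>i<length xs. a i * c i j) * u j l)"
          by (subst sum.swap) (simp add: sum_distrib_right)
        finally show ?thesis using a(2) by simp
      qed
      then show False using lin_indepD[OF lin, of a] a(1) by auto
    qed
  qed
  obtain e where e: "bij_betw e {..<card S} S"
    using ex_bij_betw_nat_finite[OF finS] by (auto simp: atLeast0LessThan)
  define xs where "xs = map (\<lambda>k. to_ff (g (e k))) [0..<card S]"
  have "lin_indep {..<card S} {..<M} (\<lambda>k l. ffderiv l (to_ff (g (e k))))"
    unfolding lin_indep_def
  proof (intro allI impI ballI)
    fix a k assume a: "\<forall>l\<in>{..<M}. (\<Sum>i<card S. a i * ffderiv l (to_ff (g (e i)))) = 0"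
      and k: "k \<in> {..<card S}"
    let ?e' = "the_inv_into {..<card S} e"
    have inv: "?e' (e i) = i" if "i < card S" for i
      using e that by (simp add: bij_betw_def the_inv_into_f_f)
    have "(\<Sum>j\<in>S. a (?e' j) * to_ff (mpderiv l (g j))) = 0" if "l \<in> {..<M}" for l
      using a that by (subst sum.reindex_bij_betw[OF e, symmetric]) (simp add: inv)
    then have "a (?e' (e k)) = 0"
      using lin_indepD[OF indep, of "\<lambda>j. a (?e' j)" "e k"] bij_betwE[OF e] k by blast
    then show "a k = 0" using inv k by simp
  qed
  then have "alg_indep_fam (card S) (\<lambda>k. to_ff (g (e k)))"
    by (rule lin_indep_jacobian_imp_alg_indep)
  then have "alg_indep_fam (card S) (\<lambda>i. xs ! i)"
    by (subst alg_indep_fam_cong[where g = "\<lambda>k. to_ff (g (e k))"]) (simp_all add: xs_def)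
  then have "alg_indep xs"
    by (simp add: alg_indep_iff xs_def)
  moreover have "set xs \<subseteq> gen_field m g"
    using S bij_betwE[OF e] by (auto simp: xs_def intro!: to_ff_in_gen_field)
  ultimately have "xs \<in> {xs. set xs \<subseteq> gen_field m g \<and> alg_indep xs}" by simp
  then have "enat (length xs) \<le> (SUP xs\<in>{xs. set xs \<subseteq> gen_field m g \<and> alg_indep xs}. enat (length xs))"
    by (rule SUP_upper)
  then show "enat (card S) \<le> (SUP xs\<in>{xs. set xs \<subseteq> gen_field m g \<and> alg_indep xs}. enat (length xs))"
    by (simp add: xs_def)
qed

section \<open>Specializing the Hessian\<close>

lemma maximal_lin_indep_subset:
  fixes v :: "'i \<Rightarrow> 'j \<Rightarrow> 'k::field"
  assumes "finite T"
  obtains S where "S \<subseteq> T" "lin_indep S L v"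
    "\<And>i. i \<in> T \<Longrightarrow> \<exists>a. \<forall>l\<in>L. v i l = (\<Sum>j\<in>S. a j * v j l)"
proof -
  have bound: "\<forall>S. S \<subseteq> T \<and> lin_indep S L v \<longrightarrow> card S < Suc (card T)"
    using card_mono[OF assms] by (auto simp: less_Suc_eq_le)
  have "{} \<subseteq> T \<and> lin_indep {} L v" by (simp add: lin_indep_def)
  then have "\<exists>S. (S \<subseteq> T \<and> lin_indep S L v) \<and>
      (\<forall>S'. S' \<subseteq> T \<and> lin_indep S' L v \<longrightarrow> card S' \<le> card S)"
    by (rule ex_has_greatest_nat[OF _ bound])
  then obtain S where S: "S \<subseteq> T" "lin_indep S L v"
    and max: "\<And>S'. S' \<subseteq> T \<Longrightarrow> lin_indep S' L v \<Longrightarrow> card S' \<le> card S"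
    by blast
  have finS: "finite S" using S(1) assms by (rule finite_subset)
  have "\<exists>a. \<forall>l\<in>L. v i l = (\<Sum>j\<in>S. a j * v j l)" if i: "i \<in> T" for i
  proof (cases "i \<in> S")
    case True
    then have "\<forall>l\<in>L. v i l = (\<Sum>j\<in>S. (if j = i then 1 else 0) * v j l)"
      using finS by (simp add: if_distrib[of "\<lambda>x. x * _"] cong: if_cong)
    then show ?thesis by (intro exI[of _ "\<lambda>j. if j = i then 1 else 0"])
  next
    case False
    then have "\<not> lin_indep (insert i S) L v"
      using max[of "insert i S"] S(1) i finS by auto
    then obtain a where a: "\<And>l. l \<in> L \<Longrightarrow> (\<Sum>j\<in>insert i S. a j * v j l) = 0"
      and nz: "\<exists>j\<in>insert i S. a j \<noteq> 0"
      unfolding lin_indep_def by blast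
    have rel: "a i * v i l + (\<Sum>j\<in>S. a j * v j l) = 0" if "l \<in> L" for l
      using a[OF that] False finS by simp
    \<comment> \<open>The dependency must involve the new row \<open>i\<close>, since
      \<open>S\<close> alone is independent.\<close>
    have "a i \<noteq> 0"
    proof
      assume ai: "a i = 0"
      then have "\<forall>j\<in>S. a j = 0"
        using lin_indepD[OF S(2), of a] rel by simp
      with ai nz show False by auto
    qed
    then have "v i l = (\<Sum>j\<in>S. - a j / a i * v j l)" if "l \<in> L" for l
    proof -
      have "a i * v i l = - (\<Sum>j\<in>S. a j * v j l)"
        using rel[OF that] by (simp add: eq_neg_iff_add_eq_0)
      then have "v i l = - (\<Sum>j\<in>S. a j * v j l) / a i"
        using \<open>a i \<noteq> 0\<close> by (simp add: field_simps)
      then show ?thesis by (simp add: sum_divide_distrib sum_negf)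
    qed
    then show ?thesis by (intro exI[of _ "\<lambda>j. - a j / a i"]) simp
  qed
  with S that show thesis by blast
qed

lemma lin_indep_mono: "lin_indep S L v \<Longrightarrow> L \<subseteq> L' \<Longrightarrow> lin_indep S L' v"
  unfolding lin_indep_def by blast

lemma lin_indep_cong:
  "(\<And>i l. i \<in> S \<Longrightarrow> l \<in> L \<Longrightarrow> v i l = w i l) \<Longrightarrow> lin_indep S L v \<longleftrightarrow> lin_indep S L w"
  unfolding lin_indep_def by simp

text \<open>By symmetry the columns are combinations of the columns in \<open>S\<close>, just as the
  rows are of the rows in \<open>S\<close>. A combination of rows in \<open>S\<close> vanishing on
  the columns in \<open>S\<close> therefore vanishes on all of \<open>L\<close>.\<close>

lemma lin_indep_principal_minor:
  fixes v :: "'i \<Rightarrow> 'i \<Rightarrow> 'k::field"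
  assumes sym: "\<And>k l. v k l = v l k" and SL: "S \<subseteq> L" and indep: "lin_indep S L v"
    and span: "\<And>k l. k \<in> L \<Longrightarrow> l \<in> L \<Longrightarrow> v k l = (\<Sum>j\<in>S. a k j * v j l)"
  shows "lin_indep S S v"
  unfolding lin_indep_def
proof (intro allI impI ballI)
  fix b i assume b: "\<forall>m\<in>S. (\<Sum>j\<in>S. b j * v j m) = 0" and i: "i \<in> S"
  have "(\<Sum>j\<in>S. b j * v j l) = 0" if l: "l \<in> L" for l
  proof -
    have "(\<Sum>j\<in>S. b j * v j l) = (\<Sum>j\<in>S. \<Sum>m\<in>S. a l m * (b j * v j m))"
    proof (intro sum.cong refl)
      fix j assume j: "j \<in> S"
      have "v j l = (\<Sum>m\<in>S. a l m * v m j)" using span[of l j] sym[of j l] l j SL by auto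
      then show "b j * v j l = (\<Sum>m\<in>S. a l m * (b j * v j m))"
        by (simp add: sum_distrib_left sym[of _ j] mult.left_commute)
    qed
    also have "\<dots> = (\<Sum>m\<in>S. a l m * (\<Sum>j\<in>S. b j * v j m))"
      by (subst sum.swap) (simp add: sum_distrib_left)
    finally show ?thesis using b by simp
  qed
  then show "b i = 0" using lin_indepD[OF indep] i by blast
qed

text \<open>A witness of nonsingularity in place of a determinant: equations between entries survive
  a substitution. Row \<open>i\<close> of the inverse exists because the rows of \<open>v\<close>
  together with one unit vector are too many for \<open>card S\<close> columns.\<close>

lemma left_inverse_exists:
  fixes v :: "'i \<Rightarrow> 'i \<Rightarrow> 'k::field"
  assumes fin: "finite S" and indep: "lin_indep S S v"
  shows "\<exists>R. \<forall>i\<in>S. \<forall>m\<in>S. (\<Sum>j\<in>S. R i j * v j m) = (if i = m then 1 else 0)"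
proof -
  have "\<exists>r. \<forall>m\<in>S. (\<Sum>j\<in>S. r j * v j m) = (if i = m then 1 else 0)" if i: "i \<in> S" for i
  proof -
    \<comment> \<open>\<open>None\<close> labels the extra vector, minus the \<open>i\<close>-th
      unit vector; independence of the rows forces its coefficient to be nonzero.\<close>
    let ?I = "insert None (Some ` S)"
    let ?A = "\<lambda>x m. case x of None \<Rightarrow> if i = m then - 1 else 0 | Some j \<Rightarrow> v j m"
    have sum: "(\<Sum>x\<in>?I. a x * ?A x m) =
        a None * (if i = m then - 1 else 0) + (\<Sum>j\<in>S. a (Some j) * v j m)" for a m
      using fin by (simp add: sum.reindex)
    have "card S < card ?I" using fin by (simp add: card_image)
    then obtain a where a: "\<exists>x\<in>?I. a x \<noteq> 0" "\<forall>m\<in>S. (\<Sum>x\<in>?I. a x * ?A x m) = 0"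
      using homogeneous_system_solution[of S ?I ?A] fin by auto
    have nz: "a None \<noteq> 0"
    proof
      assume "a None = 0"
      then have "\<forall>j\<in>S. a (Some j) = 0"
        using lin_indepD[OF indep, of "\<lambda>j. a (Some j)"] a(2) unfolding sum by simp
      with \<open>a None = 0\<close> a(1) show False by auto
    qed
    have "(\<Sum>j\<in>S. a (Some j) / a None * v j m) = (if i = m then 1 else 0)" if "m \<in> S" for m
    proof -
      have "(\<Sum>j\<in>S. a (Some j) * v j m) = a None * (if i = m then 1 else 0)"
        using a(2) that unfolding sum by (auto simp: eq_neg_iff_add_eq_0 split: if_splits)
      moreover have "(\<Sum>j\<in>S. a (Some j) / a None * v j m) = (\<Sum>j\<in>S. a (Some j) * v j m) / a None"
        by (simp add: sum_divide_distrib)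
      ultimately show ?thesis using nz by simp
    qed
    then show ?thesis by (intro exI[of _ "\<lambda>j. a (Some j) / a None"]) simp
  qed
  then show ?thesis by metis
qed

text \<open>Transposing R v = q I turns R into a right inverse of the symmetric \<open>v\<close> up
  to \<open>q\<close>, and b v = 0 gives q b = 0. The scalar \<open>q\<close> leaves room for an
  inverse whose denominators have been cleared.\<close>

lemma lin_indep_of_left_inverse:
  fixes v :: "'i \<Rightarrow> 'i \<Rightarrow> 'k::field"
  assumes fin: "finite S" and sym: "\<And>k l. v k l = v l k" and q: "q \<noteq> 0"
    and inv: "\<And>i m. i \<in> S \<Longrightarrow> m \<in> S \<Longrightarrow> (\<Sum>j\<in>S. R i j * v j m) = (if i = m then q else 0)"
  shows "lin_indep S S v"
  unfolding lin_indep_def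
proof (intro allI impI ballI)
  fix b i assume b: "\<forall>m\<in>S. (\<Sum>j\<in>S. b j * v j m) = 0" and i: "i \<in> S"
  have "0 = (\<Sum>m\<in>S. R i m * (\<Sum>j\<in>S. b j * v j m))" using b by simp
  also have "\<dots> = (\<Sum>m\<in>S. \<Sum>j\<in>S. b j * (R i m * v m j))"
    by (simp add: sum_distrib_left sym mult.left_commute)
  also have "\<dots> = (\<Sum>j\<in>S. b j * (\<Sum>m\<in>S. R i m * v m j))"
    by (subst sum.swap) (simp add: sum_distrib_left)
  also have "\<dots> = (\<Sum>j\<in>S. if i = j then b j * q else 0)"
    by (intro sum.cong) (auto simp: inv i)
  also have "\<dots> = b i * q" using fin i by simp
  finally show "b i = 0" using q by simp
qed

lemma rational_in_UNIV: "x \<in> rational_in UNIV"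
proof (cases x)
  case (Fract p q)
  then have "x = to_ff p / to_ff q" by (simp add: to_ff_def)
  then show ?thesis unfolding rational_in_def using Fract by blast
qed

section \<open>The linear substitution given by C\<close>

lemma Cmat_unit: "i < n - 1 \<Longrightarrow> Cmat n c k i = (if k = i then 1 else 0)"
  by (auto simp: Cmat_def)

lemma mpderiv_lin_subst:
  assumes "k < N" "m < n"
  shows "mpderiv m (lin_subst N n C k) = mconst (C k m)"
proof -
  have "mpderiv m (lin_subst N n C k) = (\<Sum>l<n. mconst (C k l) * (if m = l then 1 else 0))"
    using assms by (simp add: lin_subst_def mpderiv_sum mpderiv_mult mpderiv_mvar)
  then show ?thesis using assms by (simp add: if_distrib[of "\<lambda>x. _ * x"] cong: if_cong)
qed

lemma mvars_lin_subst: "mvars (lin_subst N n C k) \<subseteq> {..<n}"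
  unfolding lin_subst_def
  by (auto intro!: mvars_sum order.trans[OF mvars_mult] simp del: lessThan_iff)

lemma mpderiv_msubst_lin_subst:
  assumes "m < n"
  shows "mpderiv m (msubst (lin_subst N n C) p) =
    (\<Sum>l<N. msubst (lin_subst N n C) (mpderiv l p) * mconst (C l m))"
proof -
  have "mpderiv m (msubst (lin_subst N n C) p) =
      (\<Sum>l<N. msubst (lin_subst N n C) (mpderiv l p) * mpderiv m (lin_subst N n C l))"
    unfolding msubst_def by (intro subst.deriv_minsert) (auto simp: lin_subst_def)
  then show ?thesis using assms by (simp add: mpderiv_lin_subst)
qed

text \<open>The denominators may involve variables \<open>k \<ge> N\<close>, which \<open>lin_subst\<close> maps to \<open>0\<close>;
  they are sent to constants here instead, so that no denominator vanishes.\<close>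

definition generic_subst :: "nat \<Rightarrow> nat \<Rightarrow> (nat \<Rightarrow> 'a::comm_ring_1) \<Rightarrow> nat \<Rightarrow> 'a mpoly" where
  "generic_subst N n c k = (if k < N then lin_subst N n (Cmat n c) k else mconst (c k))"

lemma msubst_lin_subst_eq_generic:
  "mvars p \<subseteq> {..<N} \<Longrightarrow> msubst (lin_subst N n (Cmat n c)) p = minsert mconst (generic_subst N n c) p"
  unfolding msubst_def by (rule minsert_cong) (auto simp: generic_subst_def)

text \<open>The point \<open>c\<close> lies in the image of the substitution: it is attained where
  the first \<open>n - 1\<close> variables take the values \<open>c l\<close> and the next one is 1.
  So the substituted polynomial takes the nonzero value of \<open>p\<close> at
  \<open>c\<close>.\<close>

lemma generic_subst_nonzero:
  assumes "1 \<le> n" and nz: "minsert (\<lambda>a. a) c p \<noteq> 0"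
  shows "minsert mconst (generic_subst N n c) p \<noteq> 0"
proof
  interpret ev: coeff_hom "\<lambda>a::'a. a" by (rule coeff_hom_id)
  let ?y = "\<lambda>l. if l < n - 1 then c l else 1"
  have "minsert (\<lambda>a. a) ?y (generic_subst N n c k) = c k" for k
  proof (cases "k < N")
    case True
    have "minsert (\<lambda>a. a) ?y (generic_subst N n c k) =
        (\<Sum>l<n. Cmat n c k l * (if l < n - 1 then c l else 1))"
      using True by (simp add: generic_subst_def lin_subst_def ev.minsert_sum ev.minsert_mult
          ev.minsert_mconst ev.minsert_mvar)
    also have "\<dots> = (\<Sum>l<n. if l = (if k < n - 1 then k else n - 1) then c k else 0)"
      using assms(1) by (intro sum.cong) (auto simp: Cmat_def)
    also have "\<dots> = c k" using assms(1) by auto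
    finally show ?thesis .
  qed (simp add: generic_subst_def ev.minsert_mconst)
  moreover have "coeff_hom (minsert (\<lambda>a. a) ?y)"
    by unfold_locales (simp_all add: ev.minsert_add ev.minsert_mult)
  ultimately have "minsert (\<lambda>a. a) ?y (minsert mconst (generic_subst N n c) p) = minsert (\<lambda>a. a) c p"
    by (subst minsert_hom_comp[OF coeff_hom_mconst]) (simp_all add: ev.minsert_mconst)
  moreover assume "minsert mconst (generic_subst N n c) p = 0"
  ultimately show False using nz by simp
qed

theorem theorem2p5:
  fixes h :: "'a::field_char_0 mpoly" and n N :: nat
  assumes "1 \<le> n" and "n \<le> N"
    and "mvars h \<subseteq> {..<N}"
    and "\<forall>k<N. \<exists>a :: nat \<Rightarrow> 'a mpoly fract.
           \<forall>l<N. to_ff (hessian h k l) = (\<Sum>j<n - 1. a j * to_ff (hessian h j l))"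
  shows "\<exists>c :: nat \<Rightarrow> 'a.
           (\<Prod>k\<in>{n - 1..<N}. c k) \<noteq> 0 \<and>
           sym_dB_paired n N
             (\<lambda>i. \<Sum>k<N. mconst (Cmat n c k i) * msubst (lin_subst N n (Cmat n c)) (grad h k))
             (grad h) (Cmat n c)"
proof -
  let ?H = "\<lambda>k l. to_ff (hessian h k l)"
  have sym: "hessian h k l = hessian h l k" for k l
    unfolding hessian_def by (rule mpderiv_commute)
  obtain S where S: "S \<subseteq> {..<n - 1}" and indep: "lin_indep S {..<N} ?H"
    and spanS: "\<And>j. j \<in> {..<n - 1} \<Longrightarrow> \<exists>a. \<forall>l\<in>{..<N}. ?H j l = (\<Sum>i\<in>S. a i * ?H i l)"
    by (rule maximal_lin_indep_subset[of "{..<n - 1}" "{..<N}" ?H]) simp_all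
  have finS: "finite S" using S finite_subset by blast
  have Sn: "S \<subseteq> {..<n}" and SN: "S \<subseteq> {..<N}"
    using S assms(1,2) by auto
  \<comment> \<open>Transitivity: the rows that span by hypothesis are themselves combinations of
    those in \<open>S\<close>.\<close>
  have "\<exists>a. \<forall>l<N. ?H k l = (\<Sum>j\<in>S. a j * ?H j l)" if k: "k < N" for k
  proof -
    obtain a where a: "\<And>l. l < N \<Longrightarrow> ?H k l = (\<Sum>j<n - 1. a j * ?H j l)"
      using assms(4) k by blast
    have "\<forall>j\<in>{..<n - 1}. \<exists>b. \<forall>l\<in>{..<N}. ?H j l = (\<Sum>i\<in>S. b i * ?H i l)"
      using spanS by blast
    then obtain b where b: "\<And>j l. j < n - 1 \<Longrightarrow> l < N \<Longrightarrow> ?H j l = (\<Sum>i\<in>S. b j i * ?H i l)"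
      unfolding bchoice_iff by blast
    have "?H k l = (\<Sum>i\<in>S. (\<Sum>j<n - 1. a j * b j i) * ?H i l)" if l: "l < N" for l
    proof -
      have "?H k l = (\<Sum>j<n - 1. \<Sum>i\<in>S. a j * b j i * ?H i l)"
        using a[OF l] l by (simp add: b sum_distrib_left mult.assoc)
      also have "\<dots> = (\<Sum>i\<in>S. (\<Sum>j<n - 1. a j * b j i) * ?H i l)"
        by (subst sum.swap) (simp add: sum_distrib_right)
      finally show ?thesis .
    qed
    then show ?thesis by (intro exI[of _ "\<lambda>i. \<Sum>j<n - 1. a j * b j i"]) simp
  qed
  then have "\<forall>k\<in>{..<N}. \<exists>a. \<forall>l<N. ?H k l = (\<Sum>j\<in>S. a j * ?H j l)" by simp
  then obtain a where a: "\<And>k l. k < N \<Longrightarrow> l < N \<Longrightarrow> ?H k l = (\<Sum>j\<in>S. a k j * ?H j l)"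
    unfolding bchoice_iff by blast
  have "lin_indep S S ?H"
    using SN indep a by (intro lin_indep_principal_minor[of ?H S "{..<N}" a]) (simp_all add: sym)
  then obtain R where R: "\<And>i m. i \<in> S \<Longrightarrow> m \<in> S \<Longrightarrow>
      (\<Sum>j\<in>S. R i j * ?H j m) = (if i = m then 1 else 0)"
    using left_inverse_exists[OF finS] by blast
  \<comment> \<open>Cleared of denominators, the dependences and the left inverse become polynomial
    identities, to which a substitution applies. The set is \<open>UNIV\<close> because their
    coefficients may involve any variable.\<close>
  obtain q1 P where q1: "q1 \<noteq> 0"
    and P: "\<And>kj. kj \<in> {..<N} \<times> S \<Longrightarrow> (case kj of (k, j) \<Rightarrow> a k j) = to_ff (P kj) / to_ff q1"
    by (rule common_denominator[of "{..<N} \<times> S" "\<lambda>(k, j). a k j" UNIV])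
       (use finS in \<open>auto intro: rational_in_UNIV\<close>)
  obtain q2 Q where q2: "q2 \<noteq> 0"
    and Q: "\<And>ij. ij \<in> S \<times> S \<Longrightarrow> (case ij of (i, j) \<Rightarrow> R i j) = to_ff (Q ij) / to_ff q2"
    by (rule common_denominator[of "S \<times> S" "\<lambda>(i, j). R i j" UNIV])
       (use finS in \<open>auto intro: rational_in_UNIV\<close>)
  have relP: "q1 * hessian h k l = (\<Sum>j\<in>S. P (k, j) * hessian h j l)" if "k < N" "l < N" for k l
  proof -
    have "to_ff (q1 * hessian h k l) = (\<Sum>j\<in>S. to_ff q1 * a k j * ?H j l)"
      using a[OF that] by (simp add: sum_distrib_left mult.assoc)
    also have "\<dots> = (\<Sum>j\<in>S. to_ff (P (k, j) * hessian h j l))"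
      using P[of "(k, _)"] that q1 by (intro sum.cong) auto
    finally show ?thesis by (simp only: to_ff_sum[symmetric] to_ff_eq_iff)
  qed
  have relQ: "(\<Sum>j\<in>S. Q (i, j) * hessian h j m) = (if i = m then q2 else 0)"
    if "i \<in> S" "m \<in> S" for i m
  proof -
    have "to_ff (\<Sum>j\<in>S. Q (i, j) * hessian h j m) = (\<Sum>j\<in>S. to_ff q2 * (R i j * ?H j m))"
      unfolding to_ff_sum using Q[of "(i, _)"] that q2 by (intro sum.cong) auto
    also have "\<dots> = to_ff (if i = m then q2 else 0)"
      using R[OF that] by (simp add: sum_distrib_left[symmetric])
    finally show ?thesis by (simp only: to_ff_eq_iff)
  qed

  interpret ev: coeff_hom "\<lambda>a::'a. a" by (rule coeff_hom_id)
  have "mvar k \<noteq> (0 :: 'a mpoly)" for k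
    using mpderiv_mvar[of k k, where 'a = 'a] by auto
  \<comment> \<open>The variables are included so that the point found next has no zero among its
    coordinates \<open>n - 1\<close> to \<open>N - 1\<close>.\<close>
  then have "q1 * q2 * (\<Prod>k\<in>{n - 1..<N}. mvar k) \<noteq> 0"
    using q1 q2 by simp
  then obtain c where "minsert (\<lambda>a. a) c (q1 * q2 * (\<Prod>k\<in>{n - 1..<N}. mvar k)) \<noteq> 0"
    using vanishing_everywhere_imp_zero by blast
  then have c: "minsert (\<lambda>a. a) c q1 \<noteq> 0" "minsert (\<lambda>a. a) c q2 \<noteq> 0"
    and prod_c: "(\<Prod>k\<in>{n - 1..<N}. c k) \<noteq> 0"
    by (simp_all add: ev.minsert_mult ev.minsert_prod ev.minsert_mvar)

  define C where "C = Cmat n c"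
  define \<sigma> where "\<sigma> = minsert mconst (generic_subst N n c)"
  define g where "g = (\<lambda>i. \<Sum>k<N. mconst (C k i) * msubst (lin_subst N n C) (grad h k))"
  have \<sigma>q: "\<sigma> q1 \<noteq> 0" "\<sigma> q2 \<noteq> 0"
    using c generic_subst_nonzero[OF assms(1)] by (simp_all add: \<sigma>_def)
  have mvars_grad: "mvars (grad h k) \<subseteq> {..<N}" for k
    unfolding grad_def using mvars_mpderiv assms(3) by (rule order.trans)
  have mvars_g: "mvars (g i) \<subseteq> {..<n}" for i
    unfolding g_def msubst_def
    by (intro mvars_sum order.trans[OF mvars_mult] Un_least mvars_minsert mvars_lin_subst) simp
  have dgrad: "mpderiv l (grad h k) = hessian h k l" for k l
    using sym[of k l] by (simp add: grad_def hessian_def)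
  have dg: "mpderiv m (g i) = (\<Sum>k<N. \<Sum>l<N. mconst (C k i) * (\<sigma> (hessian h k l) * mconst (C l m)))"
    if m: "m < n" for m i
  proof -
    have "msubst (lin_subst N n C) (mpderiv l (grad h k)) = \<sigma> (hessian h k l)" for k l
      unfolding \<sigma>_def C_def dgrad[symmetric]
      by (intro msubst_lin_subst_eq_generic order.trans[OF mvars_mpderiv mvars_grad])
    then show ?thesis
      using m by (simp add: g_def mpderiv_sum mpderiv_mult mpderiv_msubst_lin_subst sum_distrib_left)
  qed

  have trdeg_grad: "trdeg N (grad h) = enat (card S)"
  proof (rule trdeg_eq_rank[OF mvars_grad SN])
    show "\<exists>b. \<forall>l<N. to_ff (mpderiv l (grad h k)) = (\<Sum>j\<in>S. b j * ?H j l)" if "k < N" for k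
      unfolding dgrad using a[OF that] by blast
    show "lin_indep S {..<N} (\<lambda>k l. to_ff (mpderiv l (grad h k)))"
      unfolding dgrad by (rule indep)
  qed

  have trdeg_g: "trdeg n g = enat (card S)"
  proof (rule trdeg_eq_rank[OF mvars_g Sn])
    \<comment> \<open>Row \<open>j\<close> of H(Cx) C; multiplying by C^t on the left only forms
      combinations of rows, so these rows span the Jacobian once \<open>spec\<close> reduces all
      \<open>k\<close> to \<open>S\<close>.\<close>
    define u where "u = (\<lambda>j m. \<Sum>l<N. to_ff (\<sigma> (hessian h j l)) * to_ff (mconst (C l m)))"
    have spec: "to_ff (\<sigma> (hessian h k l)) =
        (\<Sum>j\<in>S. to_ff (\<sigma> (P (k, j))) / to_ff (\<sigma> q1) * to_ff (\<sigma> (hessian h j l)))"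
      if "k < N" "l < N" for k l
    proof -
      have "\<sigma> q1 * \<sigma> (hessian h k l) = (\<Sum>j\<in>S. \<sigma> (P (k, j)) * \<sigma> (hessian h j l))"
        using arg_cong[OF relP[OF that], of \<sigma>]
        by (simp add: \<sigma>_def subst.minsert_mult subst.minsert_sum)
      then have "to_ff (\<sigma> q1) * to_ff (\<sigma> (hessian h k l)) =
          (\<Sum>j\<in>S. to_ff (\<sigma> (P (k, j))) * to_ff (\<sigma> (hessian h j l)))"
        unfolding to_ff_simps(2)[symmetric] to_ff_sum[symmetric] by simp
      then have "to_ff (\<sigma> (hessian h k l)) =
          (\<Sum>j\<in>S. to_ff (\<sigma> (P (k, j))) * to_ff (\<sigma> (hessian h j l))) / to_ff (\<sigma> q1)"
        using \<sigma>q(1) by (simp add: eq_divide_eq mult.commute)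
      then show ?thesis by (simp add: sum_divide_distrib)
    qed
    fix i assume "i < n"
    define b where "b = (\<lambda>j. \<Sum>k<N. to_ff (mconst (C k i)) * (to_ff (\<sigma> (P (k, j))) / to_ff (\<sigma> q1)))"
    have "to_ff (mpderiv m (g i)) = (\<Sum>j\<in>S. b j * u j m)" if m: "m < n" for m
    proof -
      have "to_ff (mpderiv m (g i)) = (\<Sum>k<N. to_ff (mconst (C k i)) *
          (\<Sum>l<N. to_ff (\<sigma> (hessian h k l)) * to_ff (mconst (C l m))))"
        by (simp add: dg[OF m] to_ff_sum sum_distrib_left)
      also have "\<dots> = (\<Sum>k<N. to_ff (mconst (C k i)) *
          (\<Sum>j\<in>S. to_ff (\<sigma> (P (k, j))) / to_ff (\<sigma> q1) * u j m))"
      proof (rule sum.cong[OF refl], rule arg_cong2[where f = "(*)", OF refl])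
        fix k assume k: "k \<in> {..<N}"
        have "(\<Sum>l<N. to_ff (\<sigma> (hessian h k l)) * to_ff (mconst (C l m))) =
            (\<Sum>l<N. \<Sum>j\<in>S. to_ff (\<sigma> (P (k, j))) / to_ff (\<sigma> q1) *
              (to_ff (\<sigma> (hessian h j l)) * to_ff (mconst (C l m))))"
          using k by (intro sum.cong) (simp_all add: spec sum_distrib_right mult.assoc)
        also have "\<dots> = (\<Sum>j\<in>S. to_ff (\<sigma> (P (k, j))) / to_ff (\<sigma> q1) * u j m)"
          by (subst sum.swap) (simp only: u_def sum_distrib_left)
        finally show "(\<Sum>l<N. to_ff (\<sigma> (hessian h k l)) * to_ff (mconst (C l m))) =
            (\<Sum>j\<in>S. to_ff (\<sigma> (P (k, j))) / to_ff (\<sigma> q1) * u j m)" .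
      qed
      also have "\<dots> = (\<Sum>k<N. \<Sum>j\<in>S. to_ff (mconst (C k i)) *
          (to_ff (\<sigma> (P (k, j))) / to_ff (\<sigma> q1)) * u j m)"
        by (simp only: sum_distrib_left mult.assoc)
      also have "\<dots> = (\<Sum>j\<in>S. b j * u j m)"
        by (subst sum.swap) (simp only: b_def sum_distrib_right)
      finally show ?thesis .
    qed
    then show "\<exists>b. \<forall>m<n. to_ff (mpderiv m (g i)) = (\<Sum>j\<in>S. b j * u j m)" by blast
  next
    have minor: "mpderiv m (g i) = \<sigma> (hessian h i m)" if "i \<in> S" "m \<in> S" for i m
    proof -
      have im: "i < n - 1" "m < n - 1" "m < n" "i < N" "m < N" using that S assms by auto
      \<comment> \<open>Columns of C with index below \<open>n - 1\<close> are unit vectors, so a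
        single term of the double sum survives.\<close>
      have "mpderiv m (g i) = (\<Sum>k<N. \<Sum>l<N. if k = i \<and> l = m then \<sigma> (hessian h k l) else 0)"
        unfolding dg[OF im(3)] C_def using im(1,2)
        by (intro sum.cong refl) (simp add: Cmat_unit)
      also have "\<dots> = (\<Sum>k<N. if k = i then \<sigma> (hessian h k m) else 0)"
        using im(5) by (intro sum.cong) auto
      also have "\<dots> = \<sigma> (hessian h i m)" using im(4) by simp
      finally show ?thesis .
    qed
    have "lin_indep S S (\<lambda>i m. to_ff (\<sigma> (hessian h i m)))"
    \<comment> \<open>The specialized \<open>Q\<close> inverts the minor up to the nonzero factor
      \<open>\<sigma> q2\<close>.\<close>
    proof (rule lin_indep_of_left_inverse[OF finS])
      show "to_ff (\<sigma> q2) \<noteq> 0" using \<sigma>q(2) by simp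
      fix i m assume "i \<in> S" "m \<in> S"
      then have "(\<Sum>j\<in>S. \<sigma> (Q (i, j)) * \<sigma> (hessian h j m)) = (if i = m then \<sigma> q2 else 0)"
        using arg_cong[OF relQ[of i m], of \<sigma>]
        by (simp add: \<sigma>_def subst.minsert_mult subst.minsert_sum if_distrib cong: if_cong)
      then have "to_ff (\<Sum>j\<in>S. \<sigma> (Q (i, j)) * \<sigma> (hessian h j m)) = (if i = m then to_ff (\<sigma> q2) else 0)"
        by simp
      then show "(\<Sum>j\<in>S. to_ff (\<sigma> (Q (i, j))) * to_ff (\<sigma> (hessian h j m))) =
          (if i = m then to_ff (\<sigma> q2) else 0)"
        by (simp add: to_ff_sum)
    qed (simp add: sym)
    then have "lin_indep S S (\<lambda>i m. to_ff (mpderiv m (g i)))"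
      by (subst lin_indep_cong[where w = "\<lambda>i m. to_ff (\<sigma> (hessian h i m))"]) (simp_all add: minor)
    then show "lin_indep S {..<n} (\<lambda>i m. to_ff (mpderiv m (g i)))"
      using Sn by (rule lin_indep_mono)
  qed

  have "sym_dB_paired n N g (grad h) C"
    unfolding sym_dB_paired_def dB_paired_def
    using mvars_g mvars_grad trdeg_g trdeg_grad by (simp add: g_def)
  then show ?thesis
    using prod_c unfolding g_def C_def by blast
qed

end
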